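(* Let $[X_{n,i}]_{n\ge1,i\in I}$ be a partially $\mathcal G$-c.i.d. array of real-valued, square-integrable random variables, and for $n\ge1$, $i\in I$ let $$\tilde S_{n,i}=\sqrt n\big(\overline X_{n,i}-\mathbb E[X_{n+1,i}\mid\mathcal G_n]\big),\quad \overline X_{n,i}=\frac1n\sum_{k=1}^nX_{k,i},$$ $U_{n,i}=X_{n,i}-\mathbb E[X_{n,i}\mid\mathcal G_{n-1}]$, $\Delta E_{n,i}=\mathbb E[X_{n+1,i}\mid\mathcal G_n]-\mathbb E[X_{n,i}\mid\mathcal G_{n-1}]$ and $V_{n,i}=U_{n,i}-n\Delta E_{n,i}$. Assume that $\sup_n\mathbb E[\tilde S_{n,i}^2]<\infty$ for every $i\in I$, and that there are random variables $\tilde\Sigma(e_i,e_j)$, $i,j\in I$, such that $\frac1n\sum_{k=1}^nV_{k,i}V_{k,j}\to\tilde\Sigma(e_i,e_j)$ $\mathbb P$-a.s. for every $i,j\in I$. Then $(\tilde{\mathbf S}_n^I)_{n\ge1}=((\tilde S_{n,i})_{i\in I})_{n\ge1}$ converges stably with representing measure $\mathcal N(0,\tilde\Sigma)$.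
   Context: All random elements live on $(\Omega,\mathcal F,\mathbb P)$; $I$ is finite or countable; here $\mathbb X=\mathbb R$. For a filtration $\mathcal G=(\mathcal G_n)_{n\ge0}$ and $j\in I$, $\mathcal G_n^j=\mathcal G_n\vee\sigma(X_{n+1,i}:i\ne j)$. The array is partially $\mathcal G$-c.i.d. if it is adapted to $\mathcal G$ and $\mathbb E[f(X_{n+1,j})\mid\mathcal G_n^j]=\mathbb E[f(X_{n+k,j})\mid\mathcal G_n^j]$ a.s. for all $j\in I$, $k\ge1$, $n\ge0$ and bounded measurable $f$. $(e_i)_{i\in I}$ is the canonical basis of $\mathbb R^I$ ($\mathbb R^I$ with the product topology). For a (random) symmetric positive semidefinite form $\Sigma$ on $\mathbb R^I$, $\mathcal N(0,\Sigma)$ is the centered Gaussian measure on $\mathbb R^I$ whose marginal on $\mathbb R^J$ ($J$ finite) is centered Gaussian with covariance matrix $(\Sigma(e_i,e_j))_{i,j\in J}$. A sequence $(Z_n)$ of random elements of a Polish space converges stably with representing random measure $\beta(\cdot;\omega)$ if for every $A\in\mathcal F$ and every bounded continuous $g$, $\mathbb E[\mathbf 1_A g(Z_n)]\to\int_A\int g\,d\beta(\cdot;\omega)\,\mathbb P(d\omega)$. *)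

theory Defs
  imports "HOL-Probability.Probability"
begin

definition is_filtration :: "'a measure \<Rightarrow> (nat \<Rightarrow> 'a measure) \<Rightarrow> bool" where
  "is_filtration M G \<longleftrightarrow> (\<forall>n. subalgebra M (G n)) \<and> (\<forall>n m. n \<le> m \<longrightarrow> sets (G n) \<subseteq> sets (G m))"

definition Gj :: "'a measure \<Rightarrow> (nat \<Rightarrow> 'a measure) \<Rightarrow> (nat \<Rightarrow> 'i \<Rightarrow> 'a \<Rightarrow> real)
                  \<Rightarrow> nat \<Rightarrow> 'i \<Rightarrow> 'a measure" where
  "Gj M G X n j = sigma (space M)
     (sets (G n) \<union> (\<Union>i\<in>{i. i \<noteq> j}. {X (Suc n) i -` B \<inter> space M | B. B \<in> sets borel}))"

definition partially_cid :: "'a measure \<Rightarrow> (nat \<Rightarrow> 'a measure) \<Rightarrow> (nat \<Rightarrow> 'i \<Rightarrow> 'a \<Rightarrow> real) \<Rightarrow> bool" where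
  "partially_cid M G X \<longleftrightarrow>
     (\<forall>n\<ge>1. \<forall>i. X n i \<in> borel_measurable (G n)) \<and>
     (\<forall>j n k (f::real \<Rightarrow> real). k \<ge> 1 \<longrightarrow> f \<in> borel_measurable borel \<longrightarrow> bounded (range f) \<longrightarrow>
        (AE \<omega> in M. real_cond_exp M (Gj M G X n j) (\<lambda>x. f (X (Suc n) j x)) \<omega>
                   = real_cond_exp M (Gj M G X n j) (\<lambda>x. f (X (n + k) j x)) \<omega>))"

text \<open>Centered Gaussian measure on R^I (product topology) with covariance form C:
  every finite-dimensional marginal is the centered Gaussian with covariance matrix
  (C i j)_{i,j\<in>J}, expressed through its characteristic function.\<close>
definition centered_gaussian :: "('i \<Rightarrow> real) measure \<Rightarrow> ('i \<Rightarrow> 'i \<Rightarrow> real) \<Rightarrow> bool" where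
  "centered_gaussian \<mu> C \<longleftrightarrow> prob_space \<mu> \<and> sets \<mu> = sets borel \<and>
     (\<forall>J t. finite J \<longrightarrow>
        integral\<^sup>L \<mu> (\<lambda>x. cis (\<Sum>j\<in>J. t j * x j))
          = complex_of_real (exp (- (1/2) * (\<Sum>i\<in>J. \<Sum>j\<in>J. t i * t j * C i j))))"

definition stable_conv :: "'a measure \<Rightarrow> (nat \<Rightarrow> 'a \<Rightarrow> 'b::topological_space) \<Rightarrow> ('a \<Rightarrow> 'b measure) \<Rightarrow> bool" where
  "stable_conv M Z \<beta> \<longleftrightarrow>
     (\<forall>A\<in>sets M. \<forall>g::'b \<Rightarrow> real. continuous_on UNIV g \<longrightarrow> bounded (range g) \<longrightarrow>
        (\<lambda>n. \<integral>\<omega>. indicator A \<omega> * g (Z (Suc n) \<omega>) \<partial>M)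
          \<longlonglongrightarrow> (\<integral>\<omega>. indicator A \<omega> * (\<integral>x. g x \<partial>(\<beta> \<omega>)) \<partial>M))"

end

theory Submission
  imports Defs
begin

text \<open>By telescoping, \<open>sqrt n * S n i\<close> is the sum of \<open>V 1 i, \<dots>, V n i\<close>, and the
  partial c.i.d. property makes the \<open>V k i\<close> martingale differences. McLeish's argument then
  gives, for every bounded \<open>\<zeta>\<close>, the limit of \<open>E (\<zeta> * cis (\<Sum>j. t j * S n j))\<close>; the a.s.
  convergence of the averages of \<open>V k i * V k j\<close> already makes the individual terms
  negligible. The Gaussian kernel is the image of white noise under a Cholesky factor of the
  covariance, which depends measurably on it. The bounded second moments of \<open>S\<close> give
  tightness, and on compact boxes trigonometric polynomials are dense by Stone-Weierstrass.\<close>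

subsection \<open>Gaussian measures by Cholesky factorization\<close>

text \<open>Two obstacles shape the proof. Stable convergence tests against arbitrary events of
  \<open>M\<close>, and the limiting variance is itself random, so the test function
  \<open>\<zeta>\<close> need not be measurable for any \<open>G m\<close>. Hence the weak limit of
  \<open>T\<close> is proved against every bounded \<open>\<zeta>\<close>, by projecting
  \<open>\<zeta>\<close> onto \<open>G m\<close>; the factor exp (- s / 2) is then absorbed into
  \<open>\<zeta>\<close>. Secondly, no uniform moment bound on the increments is assumed. The bound
  on the second moments of \<open>S\<close> serves not only for tightness: by orthogonality of the
  increments it also bounds the averages of their second moments, which keeps \<open>T\<close>
  bounded in L2. The martingale property rests on the predictive means E(X (n+1) i | G n) forming a
  martingale: \<open>X (n+1) i\<close> and \<open>X (n+2) i\<close> have the same conditional law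
  given \<open>Gj\<close>, hence the same integrals over events of \<open>G n\<close>. Positivity of
  the limit covariance holds only almost surely, so the Gaussian kernel is built by a formula that
  yields a probability measure for every form.\<close>

text \<open>The pivots are \<open>e 0, e 1, \<dots>\<close>. Since \<open>x / 0 = 0\<close>, a zero pivot leaves the form
  unchanged; its row already vanishes by positivity, so \<open>e\<close> may repeat indices.\<close>

fun schur :: "(nat \<Rightarrow> 'i) \<Rightarrow> ('i \<Rightarrow> 'i \<Rightarrow> real) \<Rightarrow> nat \<Rightarrow> 'i \<Rightarrow> 'i \<Rightarrow> real" where
  "schur e A 0 = A"
| "schur e A (Suc k) = (\<lambda>i j. schur e A k i j
     - schur e A k i (e k) * schur e A k (e k) j / schur e A k (e k) (e k))"

definition psd_form :: "('i \<Rightarrow> 'i \<Rightarrow> real) \<Rightarrow> bool" where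
  "psd_form A \<longleftrightarrow> (\<forall>i j. A i j = A j i) \<and>
     (\<forall>J t. finite J \<longrightarrow> 0 \<le> (\<Sum>i\<in>J. \<Sum>j\<in>J. t i * t j * A i j))"

lemma psd_form_sym: "psd_form A \<Longrightarrow> A i j = A j i"
  by (auto simp: psd_form_def)

lemma psd_form_quad: "psd_form A \<Longrightarrow> finite J \<Longrightarrow> 0 \<le> (\<Sum>i\<in>J. \<Sum>j\<in>J. t i * t j * A i j)"
  by (auto simp: psd_form_def)

lemma psd_form_diag: assumes "psd_form A" shows "0 \<le> A i i"
  using psd_form_quad[OF assms, of "{i}" "\<lambda>_. 1"] by simp

text \<open>When \<open>A p p = 0\<close>, the quadratic form at the unit vector of \<open>i\<close>
  plus \<open>x\<close> times that of \<open>p\<close> is affine in \<open>x\<close> with slope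
  \<open>2 * A p i\<close>; an affine function bounded below has slope 0.\<close>

lemma psd_form_zero_pivot:
  assumes "psd_form A" "A p p = 0"
  shows "A p i = 0"
proof (rule ccontr)
  assume nz: "A p i \<noteq> 0"
  then have "i \<noteq> p" using assms(2) by auto
  \<comment> \<open>Solves \<open>A i i + 2 * x * A p i = -1\<close>.\<close>
  define x where "x = - (A i i + 1) / (2 * A p i)"
  have "0 \<le> (\<Sum>a\<in>{i,p}. \<Sum>b\<in>{i,p}. (if a = i then 1 else x) * (if b = i then 1 else x) * A a b)"
    by (rule psd_form_quad[OF assms(1)]) simp
  also have "\<dots> = A i i + 2 * x * A p i"
    using \<open>i \<noteq> p\<close> assms(2) psd_form_sym[OF assms(1), of i p] by (simp add: algebra_simps)
  also have "\<dots> = -1"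
    using nz by (simp add: x_def field_simps)
  finally show False by simp
qed

text \<open>The Schur complement at \<open>t\<close> is the minimum of the original form over shifts
  of \<open>t\<close> along the unit vector of \<open>p\<close>, attained at the shift by
  \<open>- c\<close>. It is therefore a value of a nonnegative form.\<close>

lemma psd_form_schur_step:
  assumes A: "psd_form A"
  shows "psd_form (\<lambda>i j. A i j - A i p * A p j / A p p)"
proof (cases "A p p = 0")
  case True
  then show ?thesis using A by simp
next
  case False
  have "0 \<le> (\<Sum>i\<in>J. \<Sum>j\<in>J. t i * t j * (A i j - A i p * A p j / A p p))" if J: "finite J" for J t
  proof -
    \<comment> \<open>The pivot may lie outside \<open>J\<close>, so \<open>t\<close> is first
      extended by zero to \<open>K\<close>.\<close>
    define K where "K = insert p J"
    have K: "finite K" "J \<subseteq> K" "p \<in> K" using J by (auto simp: K_def)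
    define u where "u = (\<lambda>i. if i \<in> J then t i else 0)"
    define b where "b = (\<Sum>i\<in>K. u i * A i p)"
    define c where "c = b / A p p"
    define s where "s = (\<lambda>i. u i - (if i = p then c else 0))"
    have J_K: "(\<Sum>i\<in>J. t i * f i) = (\<Sum>i\<in>K. u i * f i)" for f :: "'a \<Rightarrow> real"
      using K by (intro sum.mono_neutral_cong_left) (auto simp: u_def)
    have p_sum: "(\<Sum>i\<in>K. (if i = p then c else 0) * f i) = c * f p" for f :: "'a \<Rightarrow> real"
      using K by (simp add: if_distrib[of "\<lambda>x. x * _"] cong: if_cong)
    have b': "(\<Sum>j\<in>K. u j * A p j) = b"
      unfolding b_def using psd_form_sym[OF A] by metis
    have inner: "(\<Sum>j\<in>K. s j * A i j) = (\<Sum>j\<in>K. u j * A i j) - c * A i p" for i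
      using p_sum[of "\<lambda>j. A i j"] by (simp add: s_def left_diff_distrib sum_subtractf)
    have "0 \<le> (\<Sum>i\<in>K. \<Sum>j\<in>K. s i * s j * A i j)"
      by (rule psd_form_quad[OF A K(1)])
    also have "\<dots> = (\<Sum>i\<in>K. s i * ((\<Sum>j\<in>K. u j * A i j) - c * A i p))"
      by (simp add: inner[symmetric] sum_distrib_left mult.assoc)
    also have "\<dots> = (\<Sum>i\<in>K. u i * ((\<Sum>j\<in>K. u j * A i j) - c * A i p)) - c * (b - c * A p p)"
      using p_sum[of "\<lambda>i. (\<Sum>j\<in>K. u j * A i j) - c * A i p"] b'
      by (simp add: s_def left_diff_distrib sum_subtractf)
    also have "\<dots> = (\<Sum>i\<in>K. u i * (\<Sum>j\<in>K. u j * A i j)) - b * b / A p p"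
      using False by (simp add: right_diff_distrib sum_subtractf c_def b_def sum_distrib_left sum_distrib_right
          mult.commute mult.left_commute sum_divide_distrib)
    also have "b * b / A p p = (\<Sum>i\<in>K. u i * (A i p * b / A p p))"
      by (simp add: b_def sum_distrib_right sum_divide_distrib mult.assoc)
    also have "(\<Sum>i\<in>K. u i * (\<Sum>j\<in>K. u j * A i j)) - \<dots>
        = (\<Sum>i\<in>K. u i * ((\<Sum>j\<in>K. u j * (A i j - A i p * A p j / A p p))))"
      by (simp add: b'[symmetric] sum_subtractf[symmetric] right_diff_distrib sum_distrib_left
          sum_divide_distrib mult.commute mult.left_commute)
    also have "\<dots> = (\<Sum>i\<in>J. t i * (\<Sum>j\<in>J. t j * (A i j - A i p * A p j / A p p)))"
      unfolding J_K ..
    also have "\<dots> = (\<Sum>i\<in>J. \<Sum>j\<in>J. t i * t j * (A i j - A i p * A p j / A p p))"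
      by (simp add: sum_distrib_left mult.assoc)
    finally show ?thesis .
  qed
  moreover have "A i j - A i p * A p j / A p p = A j i - A j p * A p i / A p p" for i j
    using psd_form_sym[OF A] by (metis mult.commute)
  ultimately show ?thesis unfolding psd_form_def by blast
qed

lemma psd_form_schur: "psd_form A \<Longrightarrow> psd_form (schur e A k)"
  by (induction k) (auto intro: psd_form_schur_step)

text \<open>Step \<open>k\<close> clears row \<open>e k\<close>, by the division if the pivot is
  nonzero and by \<open>psd_form_zero_pivot\<close> otherwise. A later step subtracts from this row
  a multiple of one of its own entries, so it stays zero.\<close>

lemma schur_eliminated:
  assumes A: "psd_form A" and "k < m"
  shows "schur e A m (e k) j = 0"
  using \<open>k < m\<close>
proof (induction m arbitrary: j)
  case (Suc m)
  show ?case
  proof (cases "k = m")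
    case True
    show ?thesis
    proof (cases "schur e A m (e m) (e m) = 0")
      case True
      then have "schur e A m (e m) j = 0"
        by (rule psd_form_zero_pivot[OF psd_form_schur[OF A]])
      with True show ?thesis using \<open>k = m\<close> by simp
    qed (simp add: \<open>k = m\<close>)
  qed (use Suc in simp)
qed simp

text \<open>Column \<open>k\<close> of the triangular factor: the pivot column of the current Schur
  complement, scaled. A zero pivot gives a zero column.\<close>

definition chol :: "(nat \<Rightarrow> 'i) \<Rightarrow> ('i \<Rightarrow> 'i \<Rightarrow> real) \<Rightarrow> 'i \<Rightarrow> nat \<Rightarrow> real" where
  "chol e A i k = schur e A k i (e k) / sqrt (schur e A k (e k) (e k))"

lemma chol_eliminated: "psd_form A \<Longrightarrow> k < l \<Longrightarrow> chol e A (e k) l = 0"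
  by (simp add: chol_def schur_eliminated)

text \<open>Elimination step \<open>m\<close> removes exactly the outer product of column
  \<open>m\<close> with itself: the pivot is nonnegative, so the two square roots multiply to
  it.\<close>

lemma chol_decomposition_remainder:
  assumes A: "psd_form A"
  shows "A i j = (\<Sum>k<m. chol e A i k * chol e A j k) + schur e A m i j"
proof (induction m)
  case (Suc m)
  have "chol e A i m * chol e A j m = schur e A m i (e m) * schur e A m (e m) j / schur e A m (e m) (e m)"
    using psd_form_diag[OF psd_form_schur[OF A], of e m "e m"] psd_form_sym[OF psd_form_schur[OF A], of e m j "e m"]
    by (simp add: chol_def)
  then show ?case using Suc by simp
qed simp

text \<open>The remainder vanishes on eliminated rows, so the finite sum is exact once one of the
  two indices has served as a pivot.\<close>

lemma chol_decomposition:
  assumes "psd_form A" "k < m"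
  shows "A (e k) j = (\<Sum>l<m. chol e A (e k) l * chol e A j l)"
  using chol_decomposition_remainder[OF assms(1), of "e k" j e m] schur_eliminated[OF assms, of e j] by simp

section \<open>White noise and its image under the Cholesky factor\<close>

abbreviation white_noise :: "(nat \<Rightarrow> real) measure" where
  "white_noise \<equiv> Pi\<^sub>M UNIV (\<lambda>_. std_normal_distribution)"

text \<open>Triangularity makes each coordinate a finite sum, so no convergence question arises and
  joint measurability in \<open>A\<close> and \<open>\<xi>\<close> is elementary.\<close>

definition gauss_map :: "('i::countable \<Rightarrow> 'i \<Rightarrow> real) \<Rightarrow> (nat \<Rightarrow> real) \<Rightarrow> 'i \<Rightarrow> real" where
  "gauss_map A \<xi> i = (\<Sum>k\<le>to_nat i. chol from_nat A i k * \<xi> k)"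

lemma product_prob_space_std_normal: "product_prob_space (\<lambda>_. std_normal_distribution)"
  by (rule product_prob_spaceI) (simp add: real_distribution.axioms(1) real_dist_normal_dist)

lemma prob_space_white_noise: "prob_space white_noise"
proof -
  interpret product_prob_space "\<lambda>_. std_normal_distribution" UNIV by (rule product_prob_space_std_normal)
  show ?thesis by unfold_locales
qed

lemma sets_white_noise [measurable_cong]: "sets white_noise = sets (Pi\<^sub>M UNIV (\<lambda>_. borel))"
  by (intro sets_PiM_cong) auto

text \<open>Countability of the index type identifies the Borel sets of the product topology with
  the product sigma-algebra.\<close>

lemma measurable_into_function_space:
  fixes f :: "'a \<Rightarrow> 'i::countable \<Rightarrow> real"
  assumes "\<And>i. (\<lambda>x. f x i) \<in> borel_measurable M"
  shows "f \<in> borel_measurable M"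
proof -
  have "f \<in> M \<rightarrow>\<^sub>M Pi\<^sub>M UNIV (\<lambda>_. borel)"
    by (rule measurable_PiM_single') (use assms in auto)
  then show ?thesis
    using sets_PiM_equal_borel measurable_cong_sets by blast
qed

lemma schur_measurable [measurable (raw)]:
  assumes [measurable]: "\<And>i j. (\<lambda>\<omega>. A \<omega> i j) \<in> borel_measurable M"
  shows "(\<lambda>\<omega>. schur e (A \<omega>) k i j) \<in> borel_measurable M"
proof (induction k arbitrary: i j)
  case (Suc k)
  note Suc[measurable]
  show ?case by simp
qed simp

lemma gauss_map_measurable:
  assumes [measurable]: "\<And>i j. (\<lambda>\<omega>. A \<omega> i j) \<in> borel_measurable M"
  shows "(\<lambda>(\<omega>, \<xi>). gauss_map (A \<omega>) \<xi>) \<in> borel_measurable (M \<Otimes>\<^sub>M white_noise)"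
  by (rule measurable_into_function_space) (simp add: gauss_map_def chol_def case_prod_unfold)

text \<open>The coordinates are independent because their joint law is the product measure itself;
  the characteristic function of the sum, taken at 1, then factorizes.\<close>

lemma integral_cis_white_noise:
  "(\<integral>\<xi>. cis (\<Sum>k<m. u k * \<xi> k) \<partial>white_noise) = complex_of_real (exp (- (\<Sum>k<m. (u k)\<^sup>2) / 2))"
proof -
  interpret P: product_prob_space "\<lambda>_::nat. std_normal_distribution" UNIV by (rule product_prob_space_std_normal)
  have ind: "P.indep_vars (\<lambda>_. borel) (\<lambda>k \<xi>. u k * \<xi> k) {..<m}"
  proof -
    have "P.indep_vars (\<lambda>_. std_normal_distribution) (\<lambda>k \<xi>. \<xi> k) (UNIV::nat set)"
      by (subst P.indep_vars_iff_distr_eq_PiM) (simp_all add: P.PiM_component restrict_UNIV)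
    then have "P.indep_vars (\<lambda>_. std_normal_distribution) (\<lambda>k \<xi>. \<xi> k) {..<m}"
      by (rule P.indep_vars_subset) simp
    then show ?thesis
      by (rule P.indep_vars_compose2) simp
  qed
  have "(\<integral>\<xi>. cis (\<Sum>k<m. u k * \<xi> k) \<partial>white_noise) = char (distr white_noise borel (\<lambda>\<xi>. \<Sum>k<m. u k * \<xi> k)) 1"
    by (simp add: char_def integral_distr cis_conv_exp)
  also have "\<dots> = (\<Prod>k<m. char (distr white_noise borel (\<lambda>\<xi>. u k * \<xi> k)) 1)"
    by (rule P.char_distr_sum[OF ind])
  also have "\<dots> = (\<Prod>k<m. complex_of_real (exp (- (u k)\<^sup>2 / 2)))"
  proof (intro prod.cong refl)
    fix k
    have "char (distr white_noise borel (\<lambda>\<xi>. u k * \<xi> k)) 1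
        = char (distr (distr white_noise std_normal_distribution (\<lambda>\<xi>. \<xi> k)) borel (\<lambda>x. u k * x)) 1"
      by (subst distr_distr) (auto simp: comp_def)
    also have "distr white_noise std_normal_distribution (\<lambda>\<xi>. \<xi> k) = std_normal_distribution"
      using P.PiM_component[of k] by simp
    also have "char (distr std_normal_distribution borel (\<lambda>x. u k * x)) 1 = char std_normal_distribution (u k)"
      by (simp add: char_def integral_distr)
    finally show "char (distr white_noise borel (\<lambda>\<xi>. u k * \<xi> k)) 1 = complex_of_real (exp (- (u k)\<^sup>2 / 2))"
      by (simp add: char_std_normal_distribution)
  qed
  also have "\<dots> = complex_of_real (exp (- (\<Sum>k<m. (u k)\<^sup>2) / 2))"
    by (simp add: exp_sum[symmetric] sum_negf sum_divide_distrib flip: of_real_prod)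
  finally show ?thesis .
qed

text \<open>A linear form of \<open>gauss_map A \<xi>\<close> is a finite combination of the noise
  with weights \<open>u\<close>, and the Cholesky identity turns the sum of the squared weights into
  the quadratic form of \<open>A\<close>.\<close>

lemma centered_gaussian_gauss_map:
  assumes A: "psd_form A"
  shows "centered_gaussian (distr white_noise borel (gauss_map A)) A"
proof -
  interpret W: prob_space white_noise by (rule prob_space_white_noise)
  have [measurable]: "gauss_map A \<in> borel_measurable white_noise"
    by (rule measurable_into_function_space) (simp add: gauss_map_def)
  have "(\<integral>x. cis (\<Sum>j\<in>J. t j * x j) \<partial>distr white_noise borel (gauss_map A))
      = complex_of_real (exp (- (1/2) * (\<Sum>i\<in>J. \<Sum>j\<in>J. t i * t j * A i j)))" if J: "finite J" for J t
  proof -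
    obtain m where m: "\<And>i. i \<in> J \<Longrightarrow> to_nat i < m"
      using finite_nat_set_iff_bounded[of "to_nat ` J"] J by auto
    define u where "u k = (\<Sum>i\<in>J. t i * chol from_nat A i k)" for k
    \<comment> \<open>The entries of row \<open>i\<close> beyond \<open>to_nat i\<close> are zero,
      so all coordinates in \<open>J\<close> can be summed up to the common bound
      \<open>m\<close>.\<close>
    have G: "gauss_map A \<xi> i = (\<Sum>k<m. chol from_nat A i k * \<xi> k)" if "i \<in> J" for i \<xi>
      unfolding gauss_map_def using m[OF that] chol_eliminated[OF A, of "to_nat i" _ from_nat]
      by (intro sum.mono_neutral_left) auto
    have lin: "(\<Sum>j\<in>J. t j * gauss_map A \<xi> j) = (\<Sum>k<m. u k * \<xi> k)" for \<xi>
      unfolding u_def by (simp add: G sum_distrib_left sum_distrib_right mult.assoc) (rule sum.swap)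
    have "(\<Sum>k<m. (u k)\<^sup>2) = (\<Sum>k<m. \<Sum>i\<in>J. \<Sum>j\<in>J. t i * t j * (chol from_nat A i k * chol from_nat A j k))"
      by (simp add: u_def power2_eq_square sum_product algebra_simps)
    also have "\<dots> = (\<Sum>i\<in>J. \<Sum>j\<in>J. \<Sum>k<m. t i * t j * (chol from_nat A i k * chol from_nat A j k))"
      by (subst sum.swap, intro sum.cong refl, subst sum.swap) simp
    also have "\<dots> = (\<Sum>i\<in>J. \<Sum>j\<in>J. t i * t j * A i j)"
      using chol_decomposition[OF A m, of _ from_nat] by (simp add: sum_distrib_left)
    finally have u2: "(\<Sum>k<m. (u k)\<^sup>2) = (\<Sum>i\<in>J. \<Sum>j\<in>J. t i * t j * A i j)" .
    have [measurable]: "(\<lambda>x::'a \<Rightarrow> real. cis (\<Sum>j\<in>J. t j * x j)) \<in> borel_measurable borel"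
      by (intro borel_measurable_continuous_onI continuous_intros continuous_on_product_coordinates)
    show ?thesis
      by (simp add: integral_distr lin integral_cis_white_noise u2)
  qed
  then show ?thesis
    by (simp add: centered_gaussian_def W.prob_space_distr)
qed

subsection \<open>Weak convergence from trigonometric polynomials\<close>

text \<open>The span of the real and imaginary parts of the characters. Linearity extends the
  convergence of characteristic functions to it, and the product-to-sum formulas make it an algebra,
  as Stone-Weierstrass requires.\<close>

inductive trig_poly :: "(('i \<Rightarrow> real) \<Rightarrow> real) \<Rightarrow> bool" where
  cos: "finite J \<Longrightarrow> trig_poly (\<lambda>x. cos (\<Sum>j\<in>J. t j * x j))"
| sin: "finite J \<Longrightarrow> trig_poly (\<lambda>x. sin (\<Sum>j\<in>J. t j * x j))"
| add: "trig_poly f \<Longrightarrow> trig_poly g \<Longrightarrow> trig_poly (\<lambda>x. f x + g x)"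
| cmul: "trig_poly f \<Longrightarrow> trig_poly (\<lambda>x. c * f x)"

lemma trig_poly_const: "trig_poly (\<lambda>x. c)"
  using trig_poly.cmul[OF trig_poly.cos[of "{}"], of c] by simp

lemma trig_poly_diff: "trig_poly f \<Longrightarrow> trig_poly g \<Longrightarrow> trig_poly (\<lambda>x. f x - g x)"
  using trig_poly.add[of f "\<lambda>x. (-1) * g x"] trig_poly.cmul[of g "-1"] by simp

lemma trig_poly_half: "trig_poly f \<Longrightarrow> trig_poly (\<lambda>x. f x / 2)"
  using trig_poly.cmul[of f "1/2"] by simp

text \<open>Product-to-sum formulas merge two frequencies; padding both with zeros to the union of
  the index sets yields a single linear form again.\<close>

lemma linear_form_add:
  fixes s t :: "'i \<Rightarrow> real"
  assumes "finite J" "finite K"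
  shows "(\<Sum>j\<in>J. s j * x j) + (\<Sum>j\<in>K. t j * x j)
       = (\<Sum>j\<in>J \<union> K. ((if j \<in> J then s j else 0) + (if j \<in> K then t j else 0)) * x j)"
proof -
  have "(\<Sum>j\<in>J. s j * x j) = (\<Sum>j\<in>J \<union> K. (if j \<in> J then s j else 0) * x j)"
    using assms by (intro sum.mono_neutral_cong_left) auto
  moreover have "(\<Sum>j\<in>K. t j * x j) = (\<Sum>j\<in>J \<union> K. (if j \<in> K then t j else 0) * x j)"
    using assms by (intro sum.mono_neutral_cong_left) auto
  ultimately show ?thesis by (simp add: sum.distrib distrib_right)
qed

lemma linear_form_diff:
  fixes s t :: "'i \<Rightarrow> real"
  assumes "finite J" "finite K"
  shows "(\<Sum>j\<in>J. s j * x j) - (\<Sum>j\<in>K. t j * x j)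
       = (\<Sum>j\<in>J \<union> K. ((if j \<in> J then s j else 0) + (if j \<in> K then - t j else 0)) * x j)"
  using linear_form_add[OF assms, of s x "\<lambda>j. - t j"] by (simp add: sum_negf)

lemma trig_poly_cos_mult:
  assumes J: "finite J" and g: "trig_poly g"
  shows "trig_poly (\<lambda>x. cos (\<Sum>j\<in>J. s j * x j) * g x)"
  using g
proof induction
  case (cos K t)
  show ?case
    unfolding cos_times_cos linear_form_add[OF J cos] linear_form_diff[OF J cos]
    by (intro trig_poly_half trig_poly.add trig_poly.cos finite_UnI J cos)
next
  case (sin K t)
  show ?case
    unfolding cos_times_sin linear_form_add[OF J sin] linear_form_diff[OF J sin]
    by (intro trig_poly_half trig_poly_diff trig_poly.sin finite_UnI J sin)
next
  case (add f g)
  then show ?case using trig_poly.add[OF add.IH] by (simp add: distrib_left)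
next
  case (cmul f c)
  then show ?case using trig_poly.cmul[OF cmul.IH, of c] by (simp add: mult.left_commute)
qed

lemma trig_poly_sin_mult:
  assumes J: "finite J" and g: "trig_poly g"
  shows "trig_poly (\<lambda>x. sin (\<Sum>j\<in>J. s j * x j) * g x)"
  using g
proof induction
  case (cos K t)
  show ?case
    unfolding sin_times_cos linear_form_add[OF J cos] linear_form_diff[OF J cos]
    by (intro trig_poly_half trig_poly.add trig_poly.sin finite_UnI J cos)
next
  case (sin K t)
  show ?case
    unfolding sin_times_sin linear_form_add[OF J sin] linear_form_diff[OF J sin]
    by (intro trig_poly_half trig_poly_diff trig_poly.cos finite_UnI J sin)
next
  case (add f g)
  then show ?case using trig_poly.add[OF add.IH] by (simp add: distrib_left)
next
  case (cmul f c)
  then show ?case using trig_poly.cmul[OF cmul.IH, of c] by (simp add: mult.left_commute)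
qed

lemma trig_poly_mult:
  assumes "trig_poly f" "trig_poly g"
  shows "trig_poly (\<lambda>x. f x * g x)"
  using assms(1)
proof induction
  case (add f f')
  then show ?case using trig_poly.add[OF add.IH] by (simp add: distrib_right)
next
  case (cmul f c)
  then show ?case using trig_poly.cmul[OF cmul.IH, of c] by (simp add: mult.assoc)
qed (use assms(2) in \<open>auto intro: trig_poly_cos_mult trig_poly_sin_mult\<close>)

lemma trig_poly_continuous: "trig_poly (f :: ('i::countable \<Rightarrow> real) \<Rightarrow> real) \<Longrightarrow> continuous_on S f"
  by (rule continuous_on_subset[OF _ subset_UNIV], induction rule: trig_poly.induct)
     (auto intro!: continuous_on_cos continuous_on_sin continuous_on_sum continuous_on_mult continuous_on_add
       continuous_on_const continuous_on_product_coordinates)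

lemma trig_poly_bounded: "trig_poly f \<Longrightarrow> \<exists>C. \<forall>x. \<bar>f x\<bar> \<le> C"
proof (induction rule: trig_poly.induct)
  case (add f g)
  then obtain C D where C: "\<And>x. \<bar>f x\<bar> \<le> C" and D: "\<And>x. \<bar>g x\<bar> \<le> D" by blast
  have "\<bar>f x + g x\<bar> \<le> C + D" for x using C[of x] D[of x] by linarith
  then show ?case by blast
next
  case (cmul f c)
  then obtain C where "\<And>x. \<bar>f x\<bar> \<le> C" by blast
  then have "\<bar>c * f x\<bar> \<le> \<bar>c\<bar> * C" for x by (simp add: abs_mult mult_left_mono)
  then show ?case by blast
qed (auto intro: exI[of _ 1])

lemma trig_poly_separates:
  assumes "x \<noteq> y"
  shows "\<exists>f. trig_poly f \<and> f x \<noteq> f y"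
proof -
  obtain i where i: "x i \<noteq> y i" using assms by auto
  \<comment> \<open>This scale makes the phases at \<open>x\<close> and \<open>y\<close> differ by
    exactly 1, which is not a period of cosine and sine.\<close>
  define s where "s = 1 / (x i - y i)"
  have one: "s * x i - s * y i = 1" using i by (simp add: s_def diff_divide_distrib[symmetric])
  have t: "trig_poly (\<lambda>z. cos (s * z i))" "trig_poly (\<lambda>z. sin (s * z i))"
    using trig_poly.cos[of "{i}" "\<lambda>_. s"] trig_poly.sin[of "{i}" "\<lambda>_. s"] by simp_all
  have "cos (s * x i) \<noteq> cos (s * y i) \<or> sin (s * x i) \<noteq> sin (s * y i)"
  proof (rule ccontr)
    assume "\<not> ?thesis"
    then have "cos (s * x i - s * y i) = 1"
      by (simp add: cos_diff flip: power2_eq_square)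
    with one have "cos (1::real) = 1" by simp
    then show False using cos_monotone_0_pi[of 0 1] pi_gt3 by simp
  qed
  then show ?thesis using t by blast
qed

lemma trig_poly_comp:
  fixes q :: "real \<Rightarrow> real"
  assumes "real_polynomial_function q" "trig_poly p"
  shows "trig_poly (\<lambda>x. q (p x))"
  using assms(1)
proof induction
  case (linear f)
  then obtain c where "\<And>y. f y = y * c"
    by (meson real_bounded_linear)
  then show ?case using trig_poly.cmul[OF assms(2), of c] by (simp add: mult.commute)
qed (auto intro: trig_poly_const trig_poly.add trig_poly_mult)

text \<open>Composing a Stone-Weierstrass approximant with a polynomial close to the truncation at
  level \<open>B\<close> keeps it bounded by \<open>B + e\<close> off the compact set as well.\<close>

lemma trig_poly_approx:
  fixes g :: "('i::countable \<Rightarrow> real) \<Rightarrow> real"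
  assumes K: "compact K" and g: "continuous_on K g" "\<And>x. \<bar>g x\<bar> \<le> B" and e: "0 < e"
  obtains T where "trig_poly T" "\<And>x. x \<in> K \<Longrightarrow> \<bar>g x - T x\<bar> \<le> 2 * e" "\<And>x. \<bar>T x\<bar> \<le> B + e"
proof -
  have "\<exists>p. trig_poly p \<and> (\<forall>x\<in>K. \<bar>g x - p x\<bar> < e)"
    by (rule Stone_Weierstrass_HOL[OF K])
       (use g(1) e in \<open>auto intro: trig_poly_const trig_poly.add trig_poly_mult trig_poly_continuous
          trig_poly_separates\<close>)
  then obtain p where p: "trig_poly p" "\<And>x. x \<in> K \<Longrightarrow> \<bar>g x - p x\<bar> < e" by auto
  obtain C where C: "\<And>x. \<bar>p x\<bar> \<le> C" using trig_poly_bounded[OF p(1)] by blast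
  define \<phi> where "\<phi> y = max (- B) (min B y)" for y :: real
  have B: "0 \<le> B" using g(2)[of undefined] by linarith
  obtain q where q: "real_polynomial_function q" "\<And>y. y \<in> {-C..C} \<Longrightarrow> \<bar>\<phi> y - q y\<bar> < e"
    by (rule Stone_Weierstrass_real_polynomial_function[of "{-C..C}" \<phi> e])
       (auto simp: \<phi>_def e intro!: continuous_intros)
  have pC: "p x \<in> {-C..C}" for x using C[of x] by (auto simp: abs_le_iff)
  show ?thesis
  proof
    show "trig_poly (\<lambda>x. q (p x))" by (rule trig_poly_comp[OF q(1) p(1)])
    show "\<bar>g x - q (p x)\<bar> \<le> 2 * e" if "x \<in> K" for x
      using p(2)[OF that] q(2)[OF pC[of x]] g(2)[of x] unfolding \<phi>_def by linarith
    show "\<bar>q (p x)\<bar> \<le> B + e" for x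
      using q(2)[OF pC[of x]] B unfolding \<phi>_def by linarith
  qed
qed

section \<open>Compact boxes and tightness\<close>

lemma compact_box: "compact (Pi\<^sub>E UNIV (\<lambda>i. {- R i..R i :: real}))"
proof -
  have "compactin (product_topology (\<lambda>i. euclidean) UNIV) (Pi\<^sub>E UNIV (\<lambda>i. {- R i..R i :: real}))"
    by (subst compactin_PiE) auto
  then show ?thesis by (simp add: euclidean_product_topology)
qed

text \<open>Coordinate \<open>from_nat k\<close> may lose mass \<open>e * (1/2) ^ Suc k\<close>; the
  complement of the box is covered by countably many such events. The index type is arbitrary so
  that a limit measure can later be included in the family.\<close>

lemma coordinatewise_tight_imp_tight:
  fixes \<mu> :: "'n \<Rightarrow> ('i::countable \<Rightarrow> real) measure"
  assumes fin: "\<And>n. finite_measure (\<mu> n)" and sets: "\<And>n. sets (\<mu> n) = sets borel"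
    and tight: "\<And>i e. 0 < e \<Longrightarrow> \<exists>R. \<forall>n. measure (\<mu> n) {x. R < \<bar>x i\<bar>} \<le> e"
    and e: "0 < e"
  obtains K where "compact K" "\<And>n. measure (\<mu> n) (- K) \<le> e"
proof -
  have "\<exists>R. \<forall>n. measure (\<mu> n) {x. R < \<bar>x (from_nat k)\<bar>} \<le> e * (1/2) ^ Suc k" for k
    using tight[of "e * (1/2) ^ Suc k" "from_nat k"] e by (simp del: power_Suc)
  then obtain R where R: "\<And>k n. measure (\<mu> n) {x. R k < \<bar>x (from_nat k)\<bar>} \<le> e * (1/2) ^ Suc k"
    by metis
  define K where "K = Pi\<^sub>E UNIV (\<lambda>i::'i. {- R (to_nat i)..R (to_nat i)})"
  have K: "compact K" unfolding K_def by (rule compact_box)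
  have "measure (\<mu> n) (- K) \<le> e" for n
  proof -
    interpret finite_measure "\<mu> n" by (rule fin)
    have S: "{x. R k < \<bar>x (from_nat k)\<bar>} \<in> Sigma_Algebra.sets (\<mu> n)" for k
    proof -
      have "open {x :: 'i \<Rightarrow> real. R k < \<bar>x (from_nat k)\<bar>}"
        by (intro open_Collect_less continuous_intros continuous_on_product_coordinates)
      then show ?thesis by (simp add: sets)
    qed
    have sum: "(\<lambda>k. e * (1/2) ^ Suc k) sums e"
      using sums_mult[OF power_half_series, of e] by simp
    have "- K \<subseteq> (\<Union>k. {x. R k < \<bar>x (from_nat k)\<bar>})"
    proof
      fix x assume "x \<in> - K"
      then have "\<not> (\<forall>i. x i \<in> {- R (to_nat i)..R (to_nat i)})" by (auto simp: K_def)
      then obtain i where "x i \<notin> {- R (to_nat i)..R (to_nat i)}" by blast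
      then have "R (to_nat i) < \<bar>x (from_nat (to_nat i))\<bar>" by auto
      then show "x \<in> (\<Union>k. {x. R k < \<bar>x (from_nat k)\<bar>})" by blast
    qed
    then have K_le: "measure (\<mu> n) (- K) \<le> measure (\<mu> n) (\<Union>k. {x. R k < \<bar>x (from_nat k)\<bar>})"
      using S by (intro finite_measure_mono) auto
    have summ: "summable (\<lambda>k. measure (\<mu> n) {x. R k < \<bar>x (from_nat k)\<bar>})"
      by (rule summable_comparison_test_ev[OF _ sums_summable[OF sum]]) (use R in auto)
    note K_le
    also have "measure (\<mu> n) (\<Union>k. {x. R k < \<bar>x (from_nat k)\<bar>}) \<le> (\<Sum>k. measure (\<mu> n) {x. R k < \<bar>x (from_nat k)\<bar>})"
    proof (rule finite_measure_subadditive_countably)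
      show "range (\<lambda>k. {x. R k < \<bar>x (from_nat k)\<bar>}) \<subseteq> Sigma_Algebra.sets (\<mu> n)" using S by auto
    qed (rule summ)
    also have "\<dots> \<le> e"
      using suminf_le[OF R summ sums_summable[OF sum]] sums_unique[OF sum] by linarith
    finally show ?thesis .
  qed
  with K that show ?thesis by blast
qed

text \<open>Continuity from above along sets decreasing to the empty set.\<close>

lemma single_measure_tight:
  fixes \<nu> :: "('i \<Rightarrow> real) measure"
  assumes "finite_measure \<nu>" "sets \<nu> = sets borel" and "0 < e"
  shows "\<exists>R::nat. measure \<nu> {x. real R < \<bar>x i\<bar>} \<le> e"
proof -
  interpret finite_measure \<nu> by fact
  have S: "{x. real k < \<bar>x i\<bar>} \<in> Sigma_Algebra.sets \<nu>" for k
  proof -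
    have "open {x :: 'i \<Rightarrow> real. real k < \<bar>x i\<bar>}"
      by (intro open_Collect_less continuous_intros continuous_on_product_coordinates)
    then show ?thesis by (simp add: assms)
  qed
  have "(\<lambda>k. measure \<nu> {x. real k < \<bar>x i\<bar>}) \<longlonglongrightarrow> measure \<nu> (\<Inter>k::nat. {x. real k < \<bar>x i\<bar>})"
    using S by (intro finite_Lim_measure_decseq) (auto simp: decseq_def)
  also have "(\<Inter>k::nat. {x. real k < \<bar>x i\<bar>}) = {}"
  proof -
    have "\<exists>k::nat. \<bar>x i\<bar> \<le> real k" for x :: "'i \<Rightarrow> real" using real_arch_simple by blast
    then show ?thesis by (force simp flip: not_less)
  qed
  finally have "\<forall>\<^sub>F k in sequentially. measure \<nu> {x. real k < \<bar>x i\<bar>} < e"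
    using \<open>0 < e\<close> by (intro order_tendstoD(2)) auto
  then show ?thesis
    by (meson eventually_sequentially less_imp_le order_refl)
qed

text \<open>On a compact set carrying almost all mass of every measure, \<open>g\<close> is replaced
  by a trigonometric polynomial that stays bounded elsewhere. Total mass may be below 1, because the
  measures will be laws restricted to an event.\<close>

lemma weak_conv_from_trig:
  fixes \<mu> :: "nat \<Rightarrow> ('i::countable \<Rightarrow> real) measure"
  assumes \<mu>: "\<And>n. subprob_space (\<mu> n)" "\<And>n. sets (\<mu> n) = sets borel"
    and \<nu>: "subprob_space \<nu>" "sets \<nu> = sets borel"
    and tight: "\<And>i e. 0 < e \<Longrightarrow> \<exists>R. \<forall>n. measure (\<mu> n) {x. R < \<bar>x i\<bar>} \<le> e"
    and cos: "\<And>J t. finite J \<Longrightarrow> (\<lambda>n. \<integral>x. cos (\<Sum>j\<in>J. t j * x j) \<partial>\<mu> n)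
                \<longlonglongrightarrow> (\<integral>x. cos (\<Sum>j\<in>J. t j * x j) \<partial>\<nu>)"
    and sin: "\<And>J t. finite J \<Longrightarrow> (\<lambda>n. \<integral>x. sin (\<Sum>j\<in>J. t j * x j) \<partial>\<mu> n)
                \<longlonglongrightarrow> (\<integral>x. sin (\<Sum>j\<in>J. t j * x j) \<partial>\<nu>)"
    and g: "continuous_on UNIV g" "bounded (range g)"
  shows "(\<lambda>n. \<integral>x. g x \<partial>\<mu> n) \<longlonglongrightarrow> (\<integral>x. g x \<partial>\<nu> :: real)"
proof -
  \<comment> \<open>The limit joins the sequence as \<open>None\<close>, so that one compact set
    serves all measures.\<close>
  define \<rho> where "\<rho> m = (case m of None \<Rightarrow> \<nu> | Some n \<Rightarrow> \<mu> n)" for m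
  have sub: "subprob_space (\<rho> m)" and sets: "sets (\<rho> m) = sets borel" for m
    using \<mu> \<nu> by (auto simp: \<rho>_def split: option.split)
  have fin: "finite_measure (\<rho> m)" for m using sub by (rule subprob_space.axioms(1))
  have integ: "integrable (\<rho> m) f" if f: "continuous_on UNIV f" "\<And>x. \<bar>f x\<bar> \<le> C"
    for m and f :: "('i \<Rightarrow> real) \<Rightarrow> real" and C
  proof (rule finite_measure.integrable_const_bound[OF fin, where B = C])
    show "f \<in> borel_measurable (\<rho> m)"
      using borel_measurable_continuous_onI[OF f(1)] sets by (simp cong: measurable_cong_sets)
  qed (use f in auto)
  have \<rho>_tight: "\<exists>R. \<forall>m. measure (\<rho> m) {x. R < \<bar>x i\<bar>} \<le> e" if e: "0 < e" for i e
  proof -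
    obtain R1 where R1: "\<And>n. measure (\<mu> n) {x. R1 < \<bar>x i\<bar>} \<le> e" using tight[OF e] by blast
    obtain R2 where R2: "measure \<nu> {x. real R2 < \<bar>x i\<bar>} \<le> e"
      using single_measure_tight[OF _ \<nu>(2) e] subprob_space.axioms(1)[OF \<nu>(1)] by blast
    have "measure (\<rho> m) {x. max R1 (real R2) < \<bar>x i\<bar>} \<le> e" for m
    proof -
      interpret finite_measure "\<rho> m" by (rule fin)
      have o: "{x. r < \<bar>x i\<bar>} \<in> Sigma_Algebra.sets (\<rho> m)" for r
      proof -
        have "open {x :: 'i \<Rightarrow> real. r < \<bar>x i\<bar>}"
          by (intro open_Collect_less continuous_intros continuous_on_product_coordinates)
        then show ?thesis by (simp add: sets)
      qed
      have "measure (\<rho> m) {x. max R1 (real R2) < \<bar>x i\<bar>} \<le> measure (\<rho> m) {x. r < \<bar>x i\<bar>}"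
        if "r \<le> max R1 (real R2)" for r
        using that o by (intro finite_measure_mono) auto
      from this[of R1] this[of "real R2"] R1 R2 show ?thesis
        by (cases m) (auto simp: \<rho>_def intro: order_trans)
    qed
    then show ?thesis by blast
  qed
  obtain B where B: "\<And>x. \<bar>g x\<bar> \<le> B"
    using g(2) by (auto simp: bounded_iff)
  have B0: "0 \<le> B" using B[of undefined] by linarith
  have trig: "(\<lambda>n. \<integral>x. T x \<partial>\<mu> n) \<longlonglongrightarrow> (\<integral>x. T x \<partial>\<nu>)" if "trig_poly T" for T
    using that
  proof induction
    case (add f h)
    obtain C D where "\<And>x. \<bar>f x\<bar> \<le> C" "\<And>x. \<bar>h x\<bar> \<le> D"
      using add trig_poly_bounded by metis
    then have "integrable (\<rho> m) f" "integrable (\<rho> m) h" for m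
      using integ trig_poly_continuous add by blast+
    then have "integrable (\<mu> n) f" "integrable (\<mu> n) h" "integrable \<nu> f" "integrable \<nu> h" for n
      unfolding \<rho>_def by (metis option.simps(4,5))+
    with add show ?case by (simp add: tendsto_add)
  qed (use cos sin in \<open>auto intro: tendsto_mult_left\<close>)
  show ?thesis
  proof (rule LIMSEQ_I)
    fix r :: real assume r: "0 < r"
    \<comment> \<open>Replacing \<open>g\<close> by \<open>T\<close> costs \<open>3 * e\<close>
      twice and the convergence for \<open>T\<close> costs \<open>e\<close>, in total
      \<open>7 * e < r\<close>. The bound \<open>e \<le> 1\<close> gives
      \<open>\<bar>g x - T x\<bar> \<le> 2 * B + 1\<close> off \<open>K\<close>, and
      \<open>d\<close> turns this into an error \<open>e\<close>.\<close>
    define e where "e = min 1 (r / 20)"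
    have e: "0 < e" "e \<le> 1" "e \<le> r / 20" using r by (auto simp: e_def)
    define d where "d = e / (2 * B + 1)"
    have d: "0 < d" using e B0 by (auto simp: d_def)
    obtain K where K: "compact K" "\<And>m. measure (\<rho> m) (- K) \<le> d"
      using coordinatewise_tight_imp_tight[OF fin sets \<rho>_tight d] by blast
    obtain T where T: "trig_poly T" "\<And>x. x \<in> K \<Longrightarrow> \<bar>g x - T x\<bar> \<le> 2 * e" "\<And>x. \<bar>T x\<bar> \<le> B + e"
      using trig_poly_approx[OF K(1) continuous_on_subset[OF g(1)] B e(1)] by blast
    have close: "\<bar>(\<integral>x. g x \<partial>\<rho> m) - (\<integral>x. T x \<partial>\<rho> m)\<bar> \<le> 3 * e" for m
    proof -
      interpret subprob_space "\<rho> m" by (rule sub)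
      have Kset: "- K \<in> Sigma_Algebra.sets (\<rho> m)"
        using K(1) by (simp add: sets compact_imp_closed)
      have ig: "integrable (\<rho> m) g" by (rule integ[OF g(1) B])
      have iT: "integrable (\<rho> m) T" by (rule integ[OF trig_poly_continuous[OF T(1)] T(3)])
      have "\<bar>(\<integral>x. g x \<partial>\<rho> m) - (\<integral>x. T x \<partial>\<rho> m)\<bar> = \<bar>\<integral>x. g x - T x \<partial>\<rho> m\<bar>"
        using ig iT by simp
      also have "\<dots> \<le> (\<integral>x. \<bar>g x - T x\<bar> \<partial>\<rho> m)" by (rule integral_abs_bound)
      also have "\<dots> \<le> (\<integral>x. 2 * e + (2 * B + 1) * indicator (- K) x \<partial>\<rho> m)"
      proof (rule integral_mono)
        show "integrable (\<rho> m) (\<lambda>x. \<bar>g x - T x\<bar>)" using ig iT by simp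
        show "integrable (\<rho> m) (\<lambda>x. 2 * e + (2 * B + 1) * indicator (- K) x)"
          using Kset by (intro Bochner_Integration.integrable_add integrable_mult_right integrable_const
              integrable_real_indicator) (simp_all add: less_top[symmetric])
        fix x
        show "\<bar>g x - T x\<bar> \<le> 2 * e + (2 * B + 1) * indicator (- K) x"
          using T(2)[of x] T(3)[of x] B[of x] e by (auto simp: indicator_def)
      qed
      also have "\<dots> = 2 * e * measure (\<rho> m) (space (\<rho> m)) + (2 * B + 1) * measure (\<rho> m) (- K)"
        using Kset
        by (subst Bochner_Integration.integral_add) (auto simp: less_top[symmetric] integrable_real_indicator)
      also have "\<dots> \<le> 2 * e * 1 + (2 * B + 1) * d"
        using K(2)[of m] e B0 subprob_measure_le_1[of "space (\<rho> m)"]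
        by (intro add_mono mult_left_mono) auto
      also have "\<dots> = 3 * e" using B0 by (simp add: d_def)
      finally show ?thesis .
    qed
    have "\<forall>\<^sub>F n in sequentially. dist (\<integral>x. T x \<partial>\<mu> n) (\<integral>x. T x \<partial>\<nu>) < e"
      using trig[OF T(1)] e(1) by (rule tendstoD)
    then obtain N where N: "\<And>n. n \<ge> N \<Longrightarrow> \<bar>(\<integral>x. T x \<partial>\<mu> n) - (\<integral>x. T x \<partial>\<nu>)\<bar> < e"
      by (auto simp: eventually_sequentially dist_real_def)
    have "norm ((\<integral>x. g x \<partial>\<mu> n) - (\<integral>x. g x \<partial>\<nu>)) < r" if "n \<ge> N" for n
      using N[OF that] close[of "Some n"] close[of None] e r by (simp add: \<rho>_def)
    then show "\<exists>N. \<forall>n\<ge>N. norm ((\<integral>x. g x \<partial>\<mu> n) - (\<integral>x. g x \<partial>\<nu>)) < r" by blast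
  qed
qed

subsection \<open>A product expansion of the Gaussian exponential\<close>

text \<open>The factors \<open>1 + y + y\<^sup>2 / 2\<close> and
  \<open>1 - y + y\<^sup>2 / 2\<close> multiply to \<open>1 + y ^ 4 / 4\<close>, which is at least
  1, and the first is at most \<open>exp y\<close>.\<close>

lemma exp_minus_quadratic:
  fixes y :: real
  assumes "0 \<le> y"
  shows "\<bar>exp (- y) - (1 - y)\<bar> \<le> y\<^sup>2 / 2"
proof -
  have "1 \<le> (1 + y + y\<^sup>2 / 2) * (1 - y + y\<^sup>2 / 2)"
    using assms by (simp add: algebra_simps power2_eq_square)
  moreover have pos: "0 < 1 + y + y\<^sup>2 / 2" using assms by (simp add: add_pos_nonneg)
  ultimately have "1 / (1 + y + y\<^sup>2 / 2) \<le> 1 - y + y\<^sup>2 / 2"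
    by (simp add: divide_le_eq mult.commute)
  moreover have "exp (- y) \<le> 1 / (1 + y + y\<^sup>2 / 2)"
    using exp_lower_Taylor_quadratic[OF assms] pos by (simp add: exp_minus field_simps)
  moreover have "1 - y \<le> exp (- y)" using exp_ge_add_one_self[of "- y"] by simp
  ultimately show ?thesis by (simp add: abs_le_iff)
qed

section \<open>The quotients of \<open>cis x\<close> by \<open>1 + \<i> * x\<close> and their
  products\<close>

lemma norm_one_plus_ii: "norm (1 + \<i> * of_real x) = sqrt (1 + x\<^sup>2)"
  by (simp add: cmod_def)

lemma one_plus_ii_nonzero: "1 + \<i> * of_real x \<noteq> 0"
  by (simp add: complex_eq_iff)

lemma norm_cis_quotient_le: "norm (cis x / (1 + \<i> * of_real x)) \<le> 1"
  by (simp add: norm_divide norm_one_plus_ii divide_le_eq add_pos_nonneg)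

text \<open>\<open>(1 + \<i> * x) * (1 - x\<^sup>2 / 2)\<close> agrees with the quadratic Taylor
  polynomial of \<open>cis x\<close> up to a cubic term. The Taylor remainder, the cubic term and
  the error of the exponential contribute 1/6, 1/2 and 1/4, together 11/12; the division is harmless
  since the denominator has norm at least 1.\<close>

lemma cis_quotient_approx:
  assumes x: "\<bar>x\<bar> \<le> 1"
  shows "norm (cis x / (1 + \<i> * of_real x) - of_real (exp (- x\<^sup>2 / 2))) \<le> \<bar>x\<bar> ^ 3"
proof -
  let ?z = "1 + \<i> * of_real x :: complex"
  let ?q = "of_real (exp (- x\<^sup>2 / 2)) :: complex"
  let ?r = "of_real (exp (- (x\<^sup>2 / 2)) - (1 - x\<^sup>2 / 2)) :: complex"
  have z: "1 \<le> norm ?z" "norm ?z \<le> 2"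
    using norm_triangle_ineq[of 1 "\<i> * of_real x"] x by (simp_all add: norm_one_plus_ii norm_mult)
  have cis: "norm (cis x - (1 + \<i> * of_real x - of_real (x\<^sup>2 / 2))) \<le> \<bar>x\<bar> ^ 3 / 6"
  proof -
    have "(\<Sum>k\<le>2. (\<i> * of_real x) ^ k / fact k) = 1 + \<i> * of_real x - of_real (x\<^sup>2 / 2)"
      by (simp add: numeral_2_eq_2 power2_eq_square complex_eq_iff)
    then show ?thesis
      using iexp_approx1[of x 2] by (simp add: cis_conv_exp fact_numeral)
  qed
  have r: "norm ?r \<le> (x\<^sup>2 / 2)\<^sup>2 / 2"
    using exp_minus_quadratic[of "x\<^sup>2 / 2"] by (simp only: norm_of_real) simp
  have x4: "(x\<^sup>2 / 2)\<^sup>2 / 2 \<le> \<bar>x\<bar> ^ 3 / 8"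
  proof -
    have "(x\<^sup>2 / 2)\<^sup>2 / 2 = \<bar>x\<bar> ^ 4 / 8" by (simp add: power_divide flip: power_mult)
    also have "\<dots> \<le> \<bar>x\<bar> ^ 3 / 8" using x by (intro divide_right_mono power_decreasing) auto
    finally show ?thesis .
  qed
  have "cis x - ?z * ?q = (cis x - (1 + \<i> * of_real x - of_real (x\<^sup>2 / 2))) + \<i> * of_real (x ^ 3 / 2) - ?z * ?r"
    by (simp add: algebra_simps power2_eq_square power3_eq_cube)
  moreover have "norm (\<i> * of_real (x ^ 3 / 2)) \<le> \<bar>x\<bar> ^ 3 / 2"
    by (simp add: norm_mult norm_power norm_divide)
  moreover have "norm (?z * ?r) \<le> 2 * (\<bar>x\<bar> ^ 3 / 8)"
    unfolding norm_mult using z r x4 by (intro mult_mono) auto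
  ultimately have "norm (cis x - ?z * ?q) \<le> \<bar>x\<bar> ^ 3 / 6 + \<bar>x\<bar> ^ 3 / 2 + 2 * (\<bar>x\<bar> ^ 3 / 8)"
    using cis norm_triangle_ineq4 norm_triangle_ineq by (smt (verit))
  also have "\<dots> \<le> \<bar>x\<bar> ^ 3" by simp
  finally have *: "norm (cis x - ?z * ?q) \<le> \<bar>x\<bar> ^ 3" .
  have "norm (cis x / ?z - ?q) = norm (cis x - ?z * ?q) / norm ?z"
    using one_plus_ii_nonzero[of x] by (simp add: field_simps flip: norm_divide)
  also have "\<dots> \<le> norm (cis x - ?z * ?q)"
    using z by (simp add: divide_le_eq mult_le_cancel_left1)
  finally show ?thesis using * by simp
qed

text \<open>The newest square divided by \<open>Suc n\<close> is, up to a factor tending to 1, a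
  difference of consecutive averages, hence tends to 0. The finitely many early terms are fixed, so
  \<open>n\<close> outgrows them. This takes the place of a Lindeberg condition.\<close>

lemma averages_converge_imp_terms_small:
  fixes v :: "nat \<Rightarrow> real"
  assumes lim: "(\<lambda>n. (\<Sum>k<n. (v k)\<^sup>2) / real n) \<longlonglongrightarrow> s" and e: "0 < e"
  shows "\<forall>\<^sub>F n in sequentially. \<forall>k<n. \<bar>v k / sqrt (real n)\<bar> \<le> e"
proof -
  let ?a = "\<lambda>n. (\<Sum>k<n. (v k)\<^sup>2) / real n"
  have "(\<lambda>n. ?a (Suc n) - ?a n * (real n / real (Suc n))) \<longlonglongrightarrow> s - s * 1"
    using LIMSEQ_Suc[OF lim] LIMSEQ_n_over_Suc_n[where 'a = real] lim
    by (intro tendsto_diff tendsto_mult) auto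
  moreover have "?a (Suc n) - ?a n * (real n / real (Suc n)) = (v n)\<^sup>2 / real (Suc n)" for n
    by (cases "n = 0") (simp_all add: add_divide_distrib)
  ultimately have "(\<lambda>n. (v n)\<^sup>2 / real (Suc n)) \<longlonglongrightarrow> 0" by simp
  then have "\<forall>\<^sub>F n in sequentially. (v n)\<^sup>2 / real (Suc n) < e\<^sup>2"
    using e by (intro order_tendstoD(2)) auto
  then obtain N where N: "\<And>n. n \<ge> N \<Longrightarrow> (v n)\<^sup>2 \<le> e\<^sup>2 * real (Suc n)"
    by (auto simp: eventually_sequentially field_simps intro: less_imp_le)
  define b where "b = (\<Sum>k<N. (v k)\<^sup>2)"
  have "\<forall>\<^sub>F n in sequentially. b / e\<^sup>2 \<le> real n"
    by (meson eventually_sequentially of_nat_le_iff order_trans real_arch_simple)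
  then have "\<forall>\<^sub>F n in sequentially. b / e\<^sup>2 \<le> real n \<and> 0 < n"
    using eventually_gt_at_top[of 0] by (rule eventually_conj)
  then show ?thesis
  proof eventually_elim
    case (elim n)
    show ?case
    proof (intro allI impI)
      fix k assume k: "k < n"
      have "(v k)\<^sup>2 \<le> e\<^sup>2 * real n"
      proof (cases "k < N")
        case True
        then have "(v k)\<^sup>2 \<le> b" unfolding b_def by (intro member_le_sum) auto
        also have "\<dots> \<le> e\<^sup>2 * real n" using elim e by (simp add: field_simps)
        finally show ?thesis .
      next
        case False
        then have "(v k)\<^sup>2 \<le> e\<^sup>2 * real (Suc k)" using N by simp
        also have "\<dots> \<le> e\<^sup>2 * real n" using k by (intro mult_left_mono) auto
        finally show ?thesis .
      qed
      then have "(v k / sqrt (real n))\<^sup>2 \<le> e\<^sup>2"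
        using elim by (simp add: power_divide field_simps)
      then show "\<bar>v k / sqrt (real n)\<bar> \<le> e"
        using e by (simp add: abs_le_square_iff[symmetric])
    qed
  qed
qed

lemma abs_cube: "\<bar>y::real\<bar> ^ 3 = \<bar>y\<bar> * y\<^sup>2"
  by (simp add: power3_eq_cube power2_eq_square)

text \<open>All factors have norm at most 1, so the products differ by at most the sum of the
  factorwise errors. These are cubic, hence bounded by the largest term times the sum of squares.
  The comparison product is exactly the exponential of minus half the average.\<close>

lemma cis_quotient_prod_tendsto:
  fixes v :: "nat \<Rightarrow> real"
  assumes lim: "(\<lambda>n. (\<Sum>k<n. (v k)\<^sup>2) / real n) \<longlonglongrightarrow> s"
  shows "(\<lambda>n. \<Prod>k<n. cis (v k / sqrt (real n)) / (1 + \<i> * of_real (v k / sqrt (real n))))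
           \<longlonglongrightarrow> of_real (exp (- s / 2))"
proof -
  let ?x = "\<lambda>n k. v k / sqrt (real n)"
  let ?z = "\<lambda>n k. cis (?x n k) / (1 + \<i> * of_real (?x n k))"
  let ?w = "\<lambda>n k. of_real (exp (- (?x n k)\<^sup>2 / 2)) :: complex"
  let ?a = "\<lambda>n. (\<Sum>k<n. (v k)\<^sup>2) / real n"
  have a: "(\<Sum>k<n. (?x n k)\<^sup>2) = ?a n" for n
    by (simp add: power_divide sum_divide_distrib)
  have w: "(\<Prod>k<n. ?w n k) = of_real (exp (- ?a n / 2))" for n
    by (simp add: exp_sum[symmetric] sum_negf flip: of_real_prod a sum_divide_distrib)
  have "(\<lambda>n. (\<Prod>k<n. ?z n k) - (\<Prod>k<n. ?w n k)) \<longlonglongrightarrow> 0"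
  proof (rule LIMSEQ_I)
    fix r :: real assume r: "0 < r"
    have s0: "0 \<le> s" by (rule LIMSEQ_le_const[OF lim]) (auto intro!: sum_nonneg divide_nonneg_nonneg)
    \<comment> \<open>The bound 1 admits \<open>cis_quotient_approx\<close>; the other one gives
      \<open>e * (s + 1) < r\<close>, where \<open>s + 1\<close> eventually exceeds the average of
      squares.\<close>
    define e where "e = min 1 (r / (2 * (s + 1)))"
    have e: "0 < e" "e \<le> 1" "e * (s + 1) < r"
      using r s0 by (auto simp: e_def min_def field_simps add_pos_nonneg)
    have "\<forall>\<^sub>F n in sequentially. ?a n < s + 1"
      using lim by (rule order_tendstoD) simp
    with averages_converge_imp_terms_small[OF lim e(1)]
    have "\<forall>\<^sub>F n in sequentially. norm ((\<Prod>k<n. ?z n k) - (\<Prod>k<n. ?w n k)) < r"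
    proof eventually_elim
      case (elim n)
      have "norm ((\<Prod>k<n. ?z n k) - (\<Prod>k<n. ?w n k)) \<le> (\<Sum>k<n. norm (?z n k - ?w n k))"
        by (intro norm_prod_diff norm_cis_quotient_le) simp
      also have "\<dots> \<le> (\<Sum>k<n. e * (?x n k)\<^sup>2)"
      proof (rule sum_mono)
        fix k assume "k \<in> {..<n}"
        then have x: "\<bar>?x n k\<bar> \<le> e" using elim by simp
        have "norm (?z n k - ?w n k) \<le> \<bar>?x n k\<bar> ^ 3"
          using x e by (intro cis_quotient_approx) simp
        also have "\<dots> = \<bar>?x n k\<bar> * (?x n k)\<^sup>2"
          by (rule abs_cube)
        also have "\<dots> \<le> e * (?x n k)\<^sup>2" using x by (intro mult_right_mono) auto
        finally show "norm (?z n k - ?w n k) \<le> e * (?x n k)\<^sup>2" .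
      qed
      also have "\<dots> = e * ?a n" by (simp only: sum_distrib_left[symmetric] a)
      also have "\<dots> \<le> e * (s + 1)" using elim e by (intro mult_left_mono) auto
      also have "\<dots> < r" by (rule e)
      finally show ?case .
    qed
    then show "\<exists>N. \<forall>n\<ge>N. norm ((\<Prod>k<n. ?z n k) - (\<Prod>k<n. ?w n k) - 0) < r"
      by (simp add: eventually_sequentially)
  qed
  moreover have "(\<lambda>n. \<Prod>k<n. ?w n k) \<longlonglongrightarrow> of_real (exp (- s / 2))"
    unfolding w by (intro tendsto_intros lim) simp
  ultimately have "(\<lambda>n. ((\<Prod>k<n. ?z n k) - (\<Prod>k<n. ?w n k)) + (\<Prod>k<n. ?w n k)) \<longlonglongrightarrow> 0 + of_real (exp (- s / 2))"
    by (rule tendsto_add)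
  then show ?thesis by simp
qed

subsection \<open>Martingale differences\<close>

context
  fixes M :: "'a measure"
begin

lemma integrable_mult_square_integrable:
  fixes f g :: "'a \<Rightarrow> 'b :: {real_normed_field, banach, second_countable_topology}"
  assumes [measurable]: "f \<in> borel_measurable M" "g \<in> borel_measurable M"
    and "integrable M (\<lambda>\<omega>. (norm (f \<omega>))\<^sup>2)" "integrable M (\<lambda>\<omega>. (norm (g \<omega>))\<^sup>2)"
  shows "integrable M (\<lambda>\<omega>. f \<omega> * g \<omega>)"
proof (rule Bochner_Integration.integrable_bound)
  show "integrable M (\<lambda>\<omega>. (norm (f \<omega>))\<^sup>2 + (norm (g \<omega>))\<^sup>2)" using assms by simp
  have "norm (f \<omega> * g \<omega>) \<le> (norm (f \<omega>))\<^sup>2 + (norm (g \<omega>))\<^sup>2" for \<omega>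
    using sum_squares_bound[of "norm (f \<omega>)" "norm (g \<omega>)"]
      mult_nonneg_nonneg[OF norm_ge_zero[of "f \<omega>"] norm_ge_zero[of "g \<omega>"]]
    unfolding norm_mult by linarith
  then show "AE \<omega> in M. norm (f \<omega> * g \<omega>) \<le> norm ((norm (f \<omega>))\<^sup>2 + (norm (g \<omega>))\<^sup>2)"
    by (simp add: abs_of_nonneg)
qed simp

text \<open>A weighted arithmetic-geometric inequality in the role of Cauchy-Schwarz: a small
  \<open>d\<close> absorbs a first moment that is merely bounded, provided the second one is small
  relative to \<open>d\<close>.\<close>

lemma norm_integral_mult_le:
  fixes f g :: "'a \<Rightarrow> 'b :: {real_normed_field, banach, second_countable_topology}"
  assumes [measurable]: "f \<in> borel_measurable M" "g \<in> borel_measurable M"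
    and f: "integrable M (\<lambda>\<omega>. (norm (f \<omega>))\<^sup>2)" and g: "integrable M (\<lambda>\<omega>. (norm (g \<omega>))\<^sup>2)"
    and d: "0 < d"
  shows "norm (\<integral>\<omega>. f \<omega> * g \<omega> \<partial>M)
           \<le> d * (\<integral>\<omega>. (norm (f \<omega>))\<^sup>2 \<partial>M) + (\<integral>\<omega>. (norm (g \<omega>))\<^sup>2 \<partial>M) / d"
proof -
  have "norm (f \<omega> * g \<omega>) \<le> d * (norm (f \<omega>))\<^sup>2 + (norm (g \<omega>))\<^sup>2 / d" for \<omega>
  proof -
    have "norm (f \<omega>) * norm (g \<omega>) = (sqrt d * norm (f \<omega>)) * (norm (g \<omega>) / sqrt d)"
      using d by simp
    also have "\<dots> \<le> 2 * ((sqrt d * norm (f \<omega>)) * (norm (g \<omega>) / sqrt d))"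
      using d by simp
    also have "\<dots> \<le> (sqrt d * norm (f \<omega>))\<^sup>2 + (norm (g \<omega>) / sqrt d)\<^sup>2"
      using sum_squares_bound[of "sqrt d * norm (f \<omega>)" "norm (g \<omega>) / sqrt d"] by (simp only: mult.assoc)
    also have "\<dots> = d * (norm (f \<omega>))\<^sup>2 + (norm (g \<omega>))\<^sup>2 / d"
      using d by (simp add: power_mult_distrib power_divide)
    finally show ?thesis by (simp add: norm_mult)
  qed
  then have "norm (\<integral>\<omega>. f \<omega> * g \<omega> \<partial>M) \<le> (\<integral>\<omega>. d * (norm (f \<omega>))\<^sup>2 + (norm (g \<omega>))\<^sup>2 / d \<partial>M)"
    using f g integrable_mult_square_integrable[OF assms(1-4)]
    by (intro order_trans[OF integral_norm_bound] integral_mono) auto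
  then show ?thesis using f g by simp
qed

end

text \<open>Indices start at 0, so \<open>V k\<close> is known at time \<open>Suc k\<close>. The
  martingale property is phrased as orthogonality to square-integrable variables of the past, the
  form in which it is applied to the product \<open>T\<close>, which is unbounded.\<close>

locale martingale_differences = prob_space +
  fixes G :: "nat \<Rightarrow> 'a measure" and V :: "nat \<Rightarrow> 'a \<Rightarrow> real"
  assumes filtration: "is_filtration M G"
    and V_adapted: "\<And>k. V k \<in> borel_measurable (G (Suc k))"
    and V_square: "\<And>k. integrable M (\<lambda>\<omega>. (V k \<omega>)\<^sup>2)"
    and V_orth: "\<And>k Y. Y \<in> borel_measurable (G k) \<Longrightarrow> integrable M (\<lambda>\<omega>. (Y \<omega>)\<^sup>2)
                   \<Longrightarrow> (\<integral>\<omega>. Y \<omega> * V k \<omega> \<partial>M) = 0"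
begin

lemma subalgebra_G: "subalgebra M (G n)" and subalgebra_G_mono: "n \<le> m \<Longrightarrow> subalgebra (G m) (G n)"
  using filtration by (auto simp: is_filtration_def subalgebra_def)

lemma sigma_finite_subalgebra_G: "sigma_finite_subalgebra M (G n)"
  by (rule finite_measure_subalgebra_is_sigma_finite, unfold_locales, rule subalgebra_G)

lemma measurable_mono: "f \<in> borel_measurable (G n) \<Longrightarrow> n \<le> m \<Longrightarrow> f \<in> borel_measurable (G m)"
  using measurable_from_subalg[OF subalgebra_G_mono] by blast

lemma measurable_G: "f \<in> borel_measurable (G n) \<Longrightarrow> f \<in> borel_measurable M"
  using measurable_from_subalg[OF subalgebra_G] by blast

lemma V_measurable: "V k \<in> borel_measurable M"
  using V_adapted measurable_G by blast

lemma V_adapted': "k < n \<Longrightarrow> V k \<in> borel_measurable (G n)"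
  using V_adapted measurable_mono[of "V k" "Suc k" n] by simp

lemma V_orth_complex:
  fixes Y :: "'a \<Rightarrow> complex"
  assumes [measurable]: "Y \<in> borel_measurable (G k)" and Y: "integrable M (\<lambda>\<omega>. (norm (Y \<omega>))\<^sup>2)"
  shows "(\<integral>\<omega>. Y \<omega> * of_real (V k \<omega>) \<partial>M) = 0"
proof -
  have [measurable]: "Y \<in> borel_measurable M" by (rule measurable_G[OF assms(1)])
  have int: "integrable M (\<lambda>\<omega>. Y \<omega> * of_real (V k \<omega>))"
    using Y V_square V_measurable by (intro integrable_mult_square_integrable) auto
  have sq: "integrable M (\<lambda>\<omega>. (Re (Y \<omega>))\<^sup>2)" "integrable M (\<lambda>\<omega>. (Im (Y \<omega>))\<^sup>2)"
    by (rule Bochner_Integration.integrable_bound[OF Y];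
        auto simp: cmod_def intro!: AE_I2)+
  have "(\<integral>\<omega>. Re (Y \<omega>) * V k \<omega> \<partial>M) = 0" "(\<integral>\<omega>. Im (Y \<omega>) * V k \<omega> \<partial>M) = 0"
    using sq by (auto intro!: V_orth)
  moreover have "Re (\<integral>\<omega>. Y \<omega> * of_real (V k \<omega>) \<partial>M) = (\<integral>\<omega>. Re (Y \<omega>) * V k \<omega> \<partial>M)"
    "Im (\<integral>\<omega>. Y \<omega> * of_real (V k \<omega>) \<partial>M) = (\<integral>\<omega>. Im (Y \<omega>) * V k \<omega> \<partial>M)"
    using int by (simp_all flip: integral_Re integral_Im)
  ultimately show ?thesis by (simp add: complex_eq_iff)
qed

text \<open>Freezing the sums of squares at level \<open>C * n\<close> bounds \<open>T\<close> in \<open>L\<^sup>2\<close> up to the last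
  increment.\<close>

definition stopped :: "real \<Rightarrow> nat \<Rightarrow> nat \<Rightarrow> 'a \<Rightarrow> real" where
  "stopped C n k \<omega> = (if (\<Sum>j<k. (V j \<omega>)\<^sup>2) \<le> C * real n then V k \<omega> / sqrt (real n) else 0)"

definition T :: "real \<Rightarrow> nat \<Rightarrow> nat \<Rightarrow> 'a \<Rightarrow> complex" where
  "T C n m \<omega> = (\<Prod>k<m. 1 + \<i> * of_real (stopped C n k \<omega>))"

text \<open>The sum runs over \<open>j < k\<close> only, so whether step \<open>k\<close> is frozen
  is decided before \<open>V k\<close> is seen. This preserves the martingale property of
  \<open>T\<close>.\<close>

lemma stopping_event_adapted:
  "(\<lambda>\<omega>. if (\<Sum>j<k. (V j \<omega>)\<^sup>2) \<le> C * real n then c else 0 :: complex) \<in> borel_measurable (G k)"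
proof -
  have [measurable]: "V j \<in> borel_measurable (G k)" if "j < k" for j
    using that by (rule V_adapted')
  show ?thesis by measurable
qed

lemma stopped_adapted:
  assumes "k < m"
  shows "stopped C n k \<in> borel_measurable (G m)"
proof -
  have [measurable]: "V k \<in> borel_measurable (G m)" using assms by (rule V_adapted')
  have [measurable]: "V j \<in> borel_measurable (G m)" if "j < k" for j
    using that assms V_adapted' by simp
  show ?thesis unfolding stopped_def by measurable
qed

lemma T_adapted: "T C n m \<in> borel_measurable (G m)"
proof -
  have [measurable]: "stopped C n k \<in> borel_measurable (G m)" if "k < m" for k
    using that by (rule stopped_adapted)
  show ?thesis unfolding T_def by measurable
qed

declare V_measurable [measurable]

lemma T_measurable [measurable]: "T C n m \<in> borel_measurable M"
  using T_adapted measurable_G by blast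

lemma stopped_measurable [measurable]: "stopped C n k \<in> borel_measurable M"
  using stopped_adapted[of k "Suc k"] measurable_G by blast

lemma norm_T: "(norm (T C n m \<omega>))\<^sup>2 = (\<Prod>k<m. 1 + (stopped C n k \<omega>)\<^sup>2)"
  by (simp add: T_def prod_norm[symmetric] norm_one_plus_ii prod_power_distrib add_nonneg_nonneg)

text \<open>Before freezing, \<open>1 + x \<le> exp x\<close> bounds all factors but the last by
  \<open>exp C\<close> together. The last increment may overshoot the threshold and stays as a
  linear term. Frozen factors equal 1.\<close>

lemma norm_T_le:
  assumes C: "0 \<le> C" and n: "0 < n"
  shows "(norm (T C n m \<omega>))\<^sup>2 \<le> exp C * (1 + (\<Sum>k<m. (V k \<omega>)\<^sup>2) / real n)"
proof (induction m)
  case 0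
  show ?case using C by (simp add: T_def)
next
  case (Suc m)
  show ?case
  proof (cases "(\<Sum>j<m. (V j \<omega>)\<^sup>2) \<le> C * real n")
    case True
    have s: "stopped C n k \<omega> = V k \<omega> / sqrt (real n)" if "k \<le> m" for k
    proof -
      have "(\<Sum>j<k. (V j \<omega>)\<^sup>2) \<le> (\<Sum>j<m. (V j \<omega>)\<^sup>2)" using that by (intro sum_mono2) auto
      with True show ?thesis by (simp add: stopped_def)
    qed
    have "(norm (T C n (Suc m) \<omega>))\<^sup>2 = (\<Prod>k<m. 1 + (V k \<omega>)\<^sup>2 / real n) * (1 + (V m \<omega>)\<^sup>2 / real n)"
      unfolding norm_T by (simp add: s power_divide)
    also have "\<dots> \<le> (\<Prod>k<m. exp ((V k \<omega>)\<^sup>2 / real n)) * (1 + (V m \<omega>)\<^sup>2 / real n)"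
      by (intro mult_right_mono prod_mono) (auto simp: add_nonneg_nonneg)
    also have "(\<Prod>k<m. exp ((V k \<omega>)\<^sup>2 / real n)) = exp ((\<Sum>k<m. (V k \<omega>)\<^sup>2) / real n)"
      by (simp add: exp_sum sum_divide_distrib)
    also have "\<dots> * (1 + (V m \<omega>)\<^sup>2 / real n) \<le> exp C * (1 + (\<Sum>k<Suc m. (V k \<omega>)\<^sup>2) / real n)"
      using True n by (intro mult_mono) (auto simp: divide_le_eq sum_nonneg add_nonneg_nonneg
          intro!: divide_right_mono)
    finally show ?thesis .
  next
    case False
    then have "(norm (T C n (Suc m) \<omega>))\<^sup>2 = (norm (T C n m \<omega>))\<^sup>2"
      unfolding norm_T by (simp add: stopped_def)
    also have "\<dots> \<le> exp C * (1 + (\<Sum>k<m. (V k \<omega>)\<^sup>2) / real n)" by (rule Suc)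
    also have "\<dots> \<le> exp C * (1 + (\<Sum>k<Suc m. (V k \<omega>)\<^sup>2) / real n)"
      by (intro mult_left_mono add_left_mono divide_right_mono) auto
    finally show ?thesis .
  qed
qed

text \<open>Makes the norm at most its square, so that \<open>norm_T_le\<close> also dominates
  \<open>norm (T C n m \<omega>)\<close> itself.\<close>

lemma norm_T_ge_1: "1 \<le> norm (T C n m \<omega>)"
proof -
  have "1 \<le> (norm (T C n m \<omega>))\<^sup>2"
    unfolding norm_T by (rule prod_ge_1) simp
  then show ?thesis using power2_le_imp_le[of 1 "norm (T C n m \<omega>)"] by simp
qed

lemma T_square_integrable:
  assumes "0 \<le> C" "0 < n"
  shows "integrable M (\<lambda>\<omega>. (norm (T C n m \<omega>))\<^sup>2)"
proof (rule Bochner_Integration.integrable_bound)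
  show "integrable M (\<lambda>\<omega>. exp C * (1 + (\<Sum>k<m. (V k \<omega>)\<^sup>2) / real n))"
    using V_square by simp
  show "AE \<omega> in M. norm ((norm (T C n m \<omega>))\<^sup>2) \<le> norm (exp C * (1 + (\<Sum>k<m. (V k \<omega>)\<^sup>2) / real n))"
    using norm_T_le[OF assms] by (auto simp: abs_mult sum_nonneg intro!: AE_I2 order_trans[OF _ abs_ge_self])
qed simp

lemma T_second_moment:
  assumes "0 \<le> C" "0 < n" and K: "(\<Sum>k<n. \<integral>\<omega>. (V k \<omega>)\<^sup>2 \<partial>M) / real n \<le> K"
  shows "(\<integral>\<omega>. (norm (T C n n \<omega>))\<^sup>2 \<partial>M) \<le> exp C * (1 + K)"
proof -
  have "(\<integral>\<omega>. (norm (T C n n \<omega>))\<^sup>2 \<partial>M) \<le> (\<integral>\<omega>. exp C * (1 + (\<Sum>k<n. (V k \<omega>)\<^sup>2) / real n) \<partial>M)"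
    using V_square T_square_integrable[OF assms(1,2)] norm_T_le[OF assms(1,2)]
    by (intro integral_mono) auto
  also have "\<dots> = exp C * (1 + (\<Sum>k<n. \<integral>\<omega>. (V k \<omega>)\<^sup>2 \<partial>M) / real n)"
    using V_square by (simp add: prob_space)
  also have "\<dots> \<le> exp C * (1 + K)" using K by simp
  finally show ?thesis .
qed

lemma square_integrable_bounded_mult:
  fixes f :: "'a \<Rightarrow> complex" and \<zeta> :: "'a \<Rightarrow> real"
  assumes [measurable]: "f \<in> borel_measurable M" "\<zeta> \<in> borel_measurable M"
    and B: "AE \<omega> in M. \<bar>\<zeta> \<omega>\<bar> \<le> B" and f: "integrable M (\<lambda>\<omega>. (norm (f \<omega>))\<^sup>2)"
  shows "integrable M (\<lambda>\<omega>. (norm (of_real (\<zeta> \<omega>) * f \<omega>))\<^sup>2)"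
proof (rule Bochner_Integration.integrable_bound)
  show "integrable M (\<lambda>\<omega>. B\<^sup>2 * (norm (f \<omega>))\<^sup>2)" using f by simp
  show "AE \<omega> in M. norm ((norm (of_real (\<zeta> \<omega>) * f \<omega>))\<^sup>2) \<le> norm (B\<^sup>2 * (norm (f \<omega>))\<^sup>2)"
    using B by eventually_elim
      (auto simp: norm_mult power_mult_distrib abs_mult intro!: mult_right_mono abs_le_square_iff[THEN iffD1] order_trans[OF _ abs_ge_self])
qed simp

text \<open>Each further factor adds a square-integrable variable known at time \<open>k\<close>
  times \<open>V k\<close>, whose expectation is 0 by orthogonality.\<close>

lemma T_martingale:
  assumes C: "0 \<le> C" "0 < n" and \<zeta>: "\<zeta> \<in> borel_measurable (G m)" "AE \<omega> in M. \<bar>\<zeta> \<omega>\<bar> \<le> B"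
    and "m \<le> k"
  shows "(\<integral>\<omega>. of_real (\<zeta> \<omega>) * T C n k \<omega> \<partial>M) = (\<integral>\<omega>. of_real (\<zeta> \<omega>) * T C n m \<omega> \<partial>M)"
  using \<open>m \<le> k\<close>
proof (induction k rule: dec_induct)
  case (step k)
  have [measurable]: "\<zeta> \<in> borel_measurable M" by (rule measurable_G[OF \<zeta>(1)])
  have \<zeta>_G: "\<zeta> \<in> borel_measurable (G k)" using measurable_mono \<zeta>(1) step by blast
  \<comment> \<open>The coefficient of \<open>V k\<close> in the increment, freezing indicator
    included.\<close>
  define Y where "Y \<omega> = of_real (\<zeta> \<omega>) * T C n k \<omega>
      * (if (\<Sum>j<k. (V j \<omega>)\<^sup>2) \<le> C * real n then \<i> / sqrt (real n) else 0)" for \<omega>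
  have Y_meas: "Y \<in> borel_measurable (G k)" 
    unfolding Y_def using measurable_compose[OF \<zeta>_G borel_measurable_continuous_onI[OF continuous_on_of_real_id]]
    by (intro borel_measurable_times T_adapted stopping_event_adapted)
  note [measurable] = measurable_G[OF Y_meas]
  have sq: "integrable M (\<lambda>\<omega>. (norm (of_real (\<zeta> \<omega>) * T C n k \<omega>))\<^sup>2)"
    by (rule square_integrable_bounded_mult[OF _ _ \<zeta>(2)]) (use T_square_integrable[OF C] in auto)
  have Y_sq: "integrable M (\<lambda>\<omega>. (norm (Y \<omega>))\<^sup>2)"
  proof (rule Bochner_Integration.integrable_bound[OF sq])
    have le1: "norm (if P then \<i> / sqrt (real n) else 0) \<le> 1" for P
      using C(2) by (auto simp: norm_divide)
    have "norm (Y \<omega>) \<le> norm (of_real (\<zeta> \<omega>) * T C n k \<omega>)" for \<omega>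
      unfolding Y_def by (subst norm_mult, rule mult_left_le[OF le1 norm_ge_zero])
    then show "AE \<omega> in M. norm ((norm (Y \<omega>))\<^sup>2) \<le> norm ((norm (of_real (\<zeta> \<omega>) * T C n k \<omega>))\<^sup>2)"
      by (simp add: power_mono)
  qed simp
  have int1: "integrable M (\<lambda>\<omega>. of_real (\<zeta> \<omega>) * T C n k \<omega>)"
    using integrable_mult_square_integrable[of "\<lambda>\<omega>. of_real (\<zeta> \<omega>) * T C n k \<omega>" M "\<lambda>_. 1"] sq by simp
  have int2: "integrable M (\<lambda>\<omega>. Y \<omega> * of_real (V k \<omega>))"
    using Y_sq V_square by (intro integrable_mult_square_integrable) auto
  have "of_real (\<zeta> \<omega>) * T C n (Suc k) \<omega> = of_real (\<zeta> \<omega>) * T C n k \<omega> + Y \<omega> * of_real (V k \<omega>)" for \<omega>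
    by (simp add: T_def Y_def stopped_def algebra_simps)
  then have "(\<integral>\<omega>. of_real (\<zeta> \<omega>) * T C n (Suc k) \<omega> \<partial>M)
      = (\<integral>\<omega>. of_real (\<zeta> \<omega>) * T C n k \<omega> \<partial>M) + (\<integral>\<omega>. Y \<omega> * of_real (V k \<omega>) \<partial>M)"
    using int1 int2 by simp
  then show ?case using step V_orth_complex[OF Y_meas Y_sq] by simp
qed simp


text \<open>With the number of factors fixed, every factor tends to 1 because the increments are
  divided by \<open>sqrt (real n)\<close>; \<open>norm_T_le\<close> supplies a dominating function
  uniform in \<open>n\<close>.\<close>

lemma T_initial_segment:
  assumes C: "0 \<le> C" and \<zeta>[measurable]: "\<zeta> \<in> borel_measurable M" and B: "AE \<omega> in M. \<bar>\<zeta> \<omega>\<bar> \<le> B"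
  shows "(\<lambda>n. \<integral>\<omega>. of_real (\<zeta> \<omega>) * T C n m \<omega> \<partial>M) \<longlonglongrightarrow> of_real (\<integral>\<omega>. \<zeta> \<omega> \<partial>M)"
proof -
  \<comment> \<open>The shift to \<open>Suc n\<close> keeps the divisor at least 1, as the
    dominating function requires.\<close>
  have "(\<lambda>n. \<integral>\<omega>. of_real (\<zeta> \<omega>) * T C (Suc n) m \<omega> \<partial>M) \<longlonglongrightarrow> (\<integral>\<omega>. of_real (\<zeta> \<omega>) \<partial>M)"
  proof (rule integral_dominated_convergence)
    let ?w = "\<lambda>\<omega>. B * (exp C * (1 + (\<Sum>k<m. (V k \<omega>)\<^sup>2)))"
    show "integrable M ?w" using V_square by simp
    show "AE \<omega> in M. (\<lambda>n. of_real (\<zeta> \<omega>) * T C (Suc n) m \<omega>) \<longlonglongrightarrow> of_real (\<zeta> \<omega>)"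
    proof (rule AE_I2)
      fix \<omega>
      have lim0: "(\<lambda>n. V k \<omega> / sqrt (real (Suc n))) \<longlonglongrightarrow> 0" for k
        by real_asymp
      have "(\<lambda>n. stopped C (Suc n) k \<omega>) \<longlonglongrightarrow> 0" for k
        by (rule tendsto_rabs_zero_cancel, rule tendsto_sandwich[OF _ _ tendsto_const tendsto_rabs_zero[OF lim0[of k]]])
          (auto simp: stopped_def)
      then have "(\<lambda>n. of_real (\<zeta> \<omega>) * T C (Suc n) m \<omega>) \<longlonglongrightarrow> of_real (\<zeta> \<omega>) * (\<Prod>k<m. 1 + \<i> * of_real 0)"
        unfolding T_def by (intro tendsto_intros)
      then show "(\<lambda>n. of_real (\<zeta> \<omega>) * T C (Suc n) m \<omega>) \<longlonglongrightarrow> of_real (\<zeta> \<omega>)" by simp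
    qed
    show "AE \<omega> in M. norm (of_real (\<zeta> \<omega>) * T C (Suc n) m \<omega>) \<le> ?w \<omega>" for n
      using B
    proof eventually_elim
      case (elim \<omega>)
      have "norm (T C (Suc n) m \<omega>) \<le> (norm (T C (Suc n) m \<omega>))\<^sup>2"
        using mult_right_mono[OF norm_T_ge_1[of C "Suc n" m \<omega>] norm_ge_zero[of "T C (Suc n) m \<omega>"]]
        by (simp add: power2_eq_square)
      also have "\<dots> \<le> exp C * (1 + (\<Sum>k<m. (V k \<omega>)\<^sup>2) / real (Suc n))"
        by (rule norm_T_le[OF C]) simp
      also have "\<dots> \<le> exp C * (1 + (\<Sum>k<m. (V k \<omega>)\<^sup>2) / 1)"
        by (intro mult_left_mono add_left_mono divide_left_mono sum_nonneg) auto
      finally show ?case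
        using elim by (auto simp: norm_mult intro!: mult_mono)
    qed
  qed simp_all
  then have "(\<lambda>n. \<integral>\<omega>. of_real (\<zeta> \<omega>) * T C n m \<omega> \<partial>M) \<longlonglongrightarrow> (\<integral>\<omega>. of_real (\<zeta> \<omega>) \<partial>M :: complex)"
    by (rule LIMSEQ_imp_Suc)
  then show ?thesis by simp
qed

section \<open>Weak convergence of \<open>T\<close> to 1 by projection onto the filtration\<close>

lemma bounded_cond_exp:
  assumes \<zeta>: "\<zeta> \<in> borel_measurable M" "AE \<omega> in M. \<bar>\<zeta> \<omega>\<bar> \<le> B"
  shows "AE \<omega> in M. \<bar>real_cond_exp M (G m) \<zeta> \<omega>\<bar> \<le> B"
proof -
  interpret S: sigma_finite_subalgebra M "G m" by (rule sigma_finite_subalgebra_G)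
  have i: "integrable M \<zeta>" using \<zeta> by (intro integrable_const_bound) auto
  have "AE \<omega> in M. real_cond_exp M (G m) \<zeta> \<omega> \<ge> - B" "AE \<omega> in M. real_cond_exp M (G m) \<zeta> \<omega> \<le> B"
    by (intro S.real_cond_exp_ge_c S.real_cond_exp_le_c i; use \<zeta>(2) in eventually_elim, simp)+
  then show ?thesis by eventually_elim simp
qed

text \<open>As \<open>T C n n\<close> is known at time \<open>n\<close>, \<open>\<zeta>\<close> may
  be replaced by its projection \<open>z n\<close>. These projections are Cauchy in L2 and
  \<open>T\<close> is bounded there, so \<open>z n\<close> may be replaced by \<open>z m\<close>
  with \<open>m\<close> fixed. Then \<open>T_martingale\<close> cuts the product down to
  \<open>m\<close> factors, and \<open>T_initial_segment\<close> gives the limit.\<close>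

lemma T_tends_weakly_to_1:
  assumes C: "0 \<le> C" and \<zeta>: "\<zeta> \<in> borel_measurable M" "AE \<omega> in M. \<bar>\<zeta> \<omega>\<bar> \<le> B"
    and K: "\<And>n. (\<Sum>k<n. \<integral>\<omega>. (V k \<omega>)\<^sup>2 \<partial>M) / real n \<le> K"
  shows "(\<lambda>n. \<integral>\<omega>. of_real (\<zeta> \<omega>) * T C n n \<omega> \<partial>M) \<longlonglongrightarrow> of_real (\<integral>\<omega>. \<zeta> \<omega> \<partial>M)"
proof -
  note [measurable] = \<zeta>(1)
  define z where "z m = real_cond_exp M (G m) \<zeta>" for m
  have z_G: "z m \<in> borel_measurable (G m)" for m unfolding z_def by simp
  have [measurable]: "z m \<in> borel_measurable M" for m unfolding z_def by simp
  have z_B: "AE \<omega> in M. \<bar>z m \<omega>\<bar> \<le> B" for m unfolding z_def by (rule bounded_cond_exp[OF \<zeta>])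
  have int_\<zeta>: "integrable M \<zeta>" using \<zeta> by (intro integrable_const_bound) auto
  have int_z: "integrable M (z m)" for m using z_B by (intro integrable_const_bound) auto
  have z_prod_B: "AE \<omega> in M. \<bar>z m \<omega> * z n \<omega>\<bar> \<le> B * B" for m n
    using z_B[of m] z_B[of n] by eventually_elim (auto simp: abs_mult intro!: mult_mono)
  have int_zz: "integrable M (\<lambda>\<omega>. z m \<omega> * z n \<omega>)" for m n
    using z_prod_B[of m n] by (intro integrable_const_bound[of _ "B * B"]) auto
  have cond: "(\<integral>\<omega>. Y \<omega> * z m \<omega> \<partial>M) = (\<integral>\<omega>. Y \<omega> * \<zeta> \<omega> \<partial>M)"
    if "Y \<in> borel_measurable (G m)" "integrable M (\<lambda>\<omega>. Y \<omega> * \<zeta> \<omega>)" for Y m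
    unfolding z_def using that \<zeta>(1) by (intro sigma_finite_subalgebra.real_cond_exp_intg[OF sigma_finite_subalgebra_G])
  have int_mult_bounded: "integrable M (\<lambda>\<omega>. Y \<omega> * \<eta> \<omega>)"
    if "integrable M Y" "\<eta> \<in> borel_measurable M" "AE \<omega> in M. \<bar>\<eta> \<omega>\<bar> \<le> B" for Y \<eta> :: "'a \<Rightarrow> real"
  proof (rule Bochner_Integration.integrable_bound)
    show "integrable M (\<lambda>\<omega>. B * Y \<omega>)" using that by simp
    show "(\<lambda>\<omega>. Y \<omega> * \<eta> \<omega>) \<in> borel_measurable M" using that by simp
    show "AE \<omega> in M. norm (Y \<omega> * \<eta> \<omega>) \<le> norm (B * Y \<omega>)"
      using that(3)
    proof eventually_elim
      case (elim \<omega>)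
      then have "\<bar>\<eta> \<omega>\<bar> \<le> \<bar>B\<bar>" by linarith
      then show ?case using mult_right_mono[of "\<bar>\<eta> \<omega>\<bar>" "\<bar>B\<bar>" "\<bar>Y \<omega>\<bar>"] by (simp add: abs_mult mult.commute)
    qed
  qed
  \<comment> \<open>Squared L2 distances between projections are differences of \<open>a\<close>,
    which increases and is bounded; this yields the Cauchy property without identifying a limit of
    \<open>z\<close>.\<close>
  define a where "a m = (\<integral>\<omega>. z m \<omega> * z m \<omega> \<partial>M)" for m
  have cross: "(\<integral>\<omega>. z m \<omega> * z n \<omega> \<partial>M) = a m" if "m \<le> n" for m n
    using cond[of "z m" m] cond[of "z m" n] z_G measurable_mono[OF z_G that] int_mult_bounded[OF int_z \<zeta>]
    by (simp add: a_def)
  have diff: "(\<integral>\<omega>. (z n \<omega> - z m \<omega>)\<^sup>2 \<partial>M) = a n - a m" if "m \<le> n" for m n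
  proof -
    have "(\<integral>\<omega>. (z n \<omega> - z m \<omega>)\<^sup>2 \<partial>M)
        = (\<integral>\<omega>. z n \<omega> * z n \<omega> + z m \<omega> * z m \<omega> - 2 * (z m \<omega> * z n \<omega>) \<partial>M)"
      by (intro Bochner_Integration.integral_cong) (auto simp: power2_eq_square algebra_simps)
    also have "\<dots> = a n + a m - 2 * a m" using int_zz cross[OF that] by (simp add: a_def)
    finally show ?thesis by simp
  qed
  have "incseq a"
  proof (rule incseq_SucI)
    fix m
    have "0 \<le> (\<integral>\<omega>. (z (Suc m) \<omega> - z m \<omega>)\<^sup>2 \<partial>M)" by simp
    then show "a m \<le> a (Suc m)" using diff[of m "Suc m"] by simp
  qed
  moreover have "a m \<le> B * B" for m
    unfolding a_def using z_prod_B[of m m] int_zz[of m m]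
    by (intro integral_le_const) auto
  ultimately have "convergent a"
    by (meson incseq_convergent convergentI)
  then have Cauchy_a: "Cauchy a" by (rule convergent_Cauchy)
  have reduce: "(\<integral>\<omega>. of_real (\<zeta> \<omega>) * T C n n \<omega> \<partial>M) = (\<integral>\<omega>. of_real (z n \<omega>) * T C n n \<omega> \<partial>M)"
    if n: "0 < n" for n
  proof -
    have T_int: "integrable M (T C n n)"
      using integrable_mult_square_integrable[of "T C n n" M "\<lambda>_. 1"] T_square_integrable[OF C n] by simp
    have Re_int: "integrable M (\<lambda>\<omega>. Re (T C n n \<omega>))" and Im_int: "integrable M (\<lambda>\<omega>. Im (T C n n \<omega>))"
      using T_int by simp_all
    have i: "integrable M (\<lambda>\<omega>. of_real (\<eta> \<omega>) * T C n n \<omega>)"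
      if "\<eta> \<in> borel_measurable M" "AE \<omega> in M. \<bar>\<eta> \<omega>\<bar> \<le> B" for \<eta>
      using integrable_mult_square_integrable[of "\<lambda>\<omega>. of_real (\<eta> \<omega>) * T C n n \<omega>" M "\<lambda>_. 1"] that
        square_integrable_bounded_mult[OF _ that T_square_integrable[OF C n]] by simp
    have T_G: "(\<lambda>\<omega>. Re (T C n n \<omega>)) \<in> borel_measurable (G n)" "(\<lambda>\<omega>. Im (T C n n \<omega>)) \<in> borel_measurable (G n)"
      using T_adapted by (auto intro: measurable_compose)
    have "(\<integral>\<omega>. \<zeta> \<omega> * Re (T C n n \<omega>) \<partial>M) = (\<integral>\<omega>. z n \<omega> * Re (T C n n \<omega>) \<partial>M)"
      using cond[OF T_G(1)] int_mult_bounded[OF Re_int \<zeta>] by (simp add: mult.commute)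
    moreover have "(\<integral>\<omega>. \<zeta> \<omega> * Im (T C n n \<omega>) \<partial>M) = (\<integral>\<omega>. z n \<omega> * Im (T C n n \<omega>) \<partial>M)"
      using cond[OF T_G(2)] int_mult_bounded[OF Im_int \<zeta>] by (simp add: mult.commute)
    ultimately show ?thesis
      using i[OF \<zeta>] i[OF _ z_B] by (simp add: complex_eq_iff flip: integral_Re integral_Im)
  qed
  show ?thesis
  proof (rule LIMSEQ_I)
    fix r :: real assume r: "0 < r"
    define L where "L = exp C * (1 + K)"
    have L: "(\<integral>\<omega>. (norm (T C n n \<omega>))\<^sup>2 \<partial>M) \<le> L" if "0 < n" for n
      unfolding L_def by (rule T_second_moment[OF C that K])
    have L0: "0 \<le> L" using L[of 1] by (rule order_trans[rotated]) simp_all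
    \<comment> \<open>Makes \<open>d * L < r / 3\<close>, with \<open>L + 1\<close> keeping the
      denominator positive. The tolerance \<open>d * r / 3\<close> for \<open>a\<close> becomes
      \<open>r / 3\<close> after division by \<open>d\<close>.\<close>
    define d where "d = r / 4 / (L + 1)"
    have d_pos: "0 < d" using r L0 by (simp add: d_def)
    have "d * (L + 1) = r / 4" using L0 by (metis d_def eq_divide_eq add_nonneg_eq_0_iff zero_le_one zero_neq_one)
    then have d: "0 < d" "d * L < r / 3" using d_pos r by (auto simp: distrib_left)
    obtain m where m: "\<And>n. m \<le> n \<Longrightarrow> \<bar>a n - a m\<bar> < d * r / 3"
      using Cauchy_a[unfolded Cauchy_def, rule_format, of "d * r / 3"] d r by (force simp: dist_real_def)
    have "(\<integral>\<omega>. z m \<omega> \<partial>M) = (\<integral>\<omega>. \<zeta> \<omega> \<partial>M)"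
      using cond[of "\<lambda>_. 1" m] int_\<zeta> by simp
    with T_initial_segment[OF C _ z_B[of m], of m]
    have lim_m: "(\<lambda>n. \<integral>\<omega>. of_real (z m \<omega>) * T C n m \<omega> \<partial>M) \<longlonglongrightarrow> of_real (\<integral>\<omega>. \<zeta> \<omega> \<partial>M)" by simp
    then obtain N where N: "\<And>n. N \<le> n \<Longrightarrow>
        norm ((\<integral>\<omega>. of_real (z m \<omega>) * T C n m \<omega> \<partial>M) - of_real (\<integral>\<omega>. \<zeta> \<omega> \<partial>M)) < r / 3"
      using LIMSEQ_D[OF lim_m, of "r / 3"] r by auto
    have "norm ((\<integral>\<omega>. of_real (\<zeta> \<omega>) * T C n n \<omega> \<partial>M) - of_real (\<integral>\<omega>. \<zeta> \<omega> \<partial>M)) < r"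
      if n: "max 1 (max m N) \<le> n" for n
    proof -
      have n': "0 < n" "m \<le> n" "N \<le> n" using n by auto
      have i: "integrable M (\<lambda>\<omega>. of_real (z k \<omega>) * T C n n \<omega>)" for k
        using integrable_mult_square_integrable[of "\<lambda>\<omega>. of_real (z k \<omega>) * T C n n \<omega>" M "\<lambda>_. 1"]
          square_integrable_bounded_mult[OF _ _ z_B T_square_integrable[OF C n'(1)]] by simp
      have "integrable M (\<lambda>\<omega>. (z n \<omega> - z m \<omega>)\<^sup>2)"
        using int_zz by (simp add: power2_eq_square algebra_simps)
      then have sq: "integrable M (\<lambda>\<omega>. (norm (of_real (z n \<omega> - z m \<omega>) :: complex))\<^sup>2)"
        by (simp only: norm_of_real power2_abs)
      have "(\<integral>\<omega>. of_real (\<zeta> \<omega>) * T C n n \<omega> \<partial>M) - (\<integral>\<omega>. of_real (z m \<omega>) * T C n m \<omega> \<partial>M)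
          = (\<integral>\<omega>. of_real (z n \<omega>) * T C n n \<omega> \<partial>M) - (\<integral>\<omega>. of_real (z m \<omega>) * T C n n \<omega> \<partial>M)"
        using reduce[OF n'(1)] T_martingale[OF C n'(1) z_G z_B n'(2)] by simp
      also have "\<dots> = (\<integral>\<omega>. T C n n \<omega> * of_real (z n \<omega> - z m \<omega>) \<partial>M)"
        using i by (subst Bochner_Integration.integral_diff[symmetric]) (simp_all add: algebra_simps)
      also have "norm \<dots> \<le> d * (\<integral>\<omega>. (norm (T C n n \<omega>))\<^sup>2 \<partial>M)
          + (\<integral>\<omega>. (norm (of_real (z n \<omega> - z m \<omega>) :: complex))\<^sup>2 \<partial>M) / d"
        by (rule norm_integral_mult_le[OF _ _ T_square_integrable[OF C n'(1)] sq d(1)]) simp_all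
      also have "\<dots> = d * (\<integral>\<omega>. (norm (T C n n \<omega>))\<^sup>2 \<partial>M) + (a n - a m) / d"
        by (simp only: norm_of_real power2_abs diff[OF n'(2)])
      also have "d * (\<integral>\<omega>. (norm (T C n n \<omega>))\<^sup>2 \<partial>M) + (a n - a m) / d \<le> d * L + (d * r / 3) / d"
      proof -
        have "a n - a m \<le> d * r / 3" using m[OF n'(2)] by linarith
        then show ?thesis
          using d L[OF n'(1)] by (intro add_mono mult_left_mono divide_right_mono) auto
      qed
      also have "\<dots> < r / 3 + r / 3" using d by simp
      finally have "norm ((\<integral>\<omega>. of_real (\<zeta> \<omega>) * T C n n \<omega> \<partial>M) - (\<integral>\<omega>. of_real (z m \<omega>) * T C n m \<omega> \<partial>M)) < r / 3 + r / 3" .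
      from norm_triangle_lt[OF add_strict_mono[OF this N[OF n'(3)]]]
      show ?thesis by simp
    qed
    then show "\<exists>N. \<forall>n\<ge>N. norm ((\<integral>\<omega>. of_real (\<zeta> \<omega>) * T C n n \<omega> \<partial>M) - of_real (\<integral>\<omega>. \<zeta> \<omega> \<partial>M)) < r"
      by blast
  qed
qed


text \<open>McLeish's factorization \<open>cis (\<Sum>x) = T Q\<close>: here \<open>T\<close> is bounded in \<open>L\<^sup>2\<close> and tends
  weakly to 1, while the bounded factor \<open>Q\<close> converges to \<open>exp (- s / 2)\<close> where \<open>s < C\<close>.\<close>

definition Q :: "real \<Rightarrow> nat \<Rightarrow> 'a \<Rightarrow> complex" where
  "Q C n \<omega> = (\<Prod>k<n. cis (stopped C n k \<omega>) / (1 + \<i> * of_real (stopped C n k \<omega>)))"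

lemma Q_measurable [measurable]: "Q C n \<in> borel_measurable M"
proof -
  have [measurable]: "cis \<in> borel_measurable borel"
    by (intro borel_measurable_continuous_onI continuous_intros)
  show ?thesis unfolding Q_def by measurable
qed

lemma norm_Q_le: "norm (Q C n \<omega>) \<le> 1"
  unfolding Q_def prod_norm[symmetric] by (intro prod_le_1) (use norm_cis_quotient_le in auto)

lemma T_Q: "T C n n \<omega> * Q C n \<omega> = cis (\<Sum>k<n. stopped C n k \<omega>)"
proof -
  have "cis (\<Sum>k<n. x k) = (\<Prod>k<n. cis (x k))" for x :: "nat \<Rightarrow> real" and n
    by (induction n) (simp_all flip: cis_mult)
  then show ?thesis
    unfolding T_def Q_def prod.distrib[symmetric] using one_plus_ii_nonzero
    by (simp add: nonzero_mult_div_cancel_left)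
qed

text \<open>Once the full sum of squares lies below the threshold \<open>C * n\<close>, so do all
  its partial sums, and no step of that row is frozen.\<close>

lemma eventually_not_stopped:
  assumes "(\<lambda>n. (\<Sum>k<n. (V k \<omega>)\<^sup>2) / real n) \<longlonglongrightarrow> s" "s < C"
  shows "\<forall>\<^sub>F n in sequentially. \<forall>k<n. stopped C n k \<omega> = V k \<omega> / sqrt (real n)"
proof -
  have "\<forall>\<^sub>F n in sequentially. (\<Sum>k<n. (V k \<omega>)\<^sup>2) / real n < C"
    using assms by (rule order_tendstoD)
  with eventually_gt_at_top[of 0] show ?thesis
  proof eventually_elim
    case (elim n)
    show ?case
    proof (intro allI impI)
      fix k assume "k < n"
      then have "(\<Sum>j<k. (V j \<omega>)\<^sup>2) \<le> (\<Sum>j<n. (V j \<omega>)\<^sup>2)" by (intro sum_mono2) auto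
      also have "\<dots> \<le> C * real n" using elim by (simp add: field_simps)
      finally show "stopped C n k \<omega> = V k \<omega> / sqrt (real n)" by (simp add: stopped_def)
    qed
  qed
qed

lemma Q_tendsto:
  assumes "(\<lambda>n. (\<Sum>k<n. (V k \<omega>)\<^sup>2) / real n) \<longlonglongrightarrow> s" "s < C"
  shows "(\<lambda>n. Q C n \<omega>) \<longlonglongrightarrow> of_real (exp (- s / 2))"
proof (rule Lim_transform_eventually[OF cis_quotient_prod_tendsto[OF assms(1)]])
  show "\<forall>\<^sub>F n in sequentially. (\<Prod>k<n. cis (V k \<omega> / sqrt (real n)) / (1 + \<i> * of_real (V k \<omega> / sqrt (real n)))) = Q C n \<omega>"
    using eventually_not_stopped[OF assms] by eventually_elim (simp add: Q_def)
qed

text \<open>The support condition makes freezing irrelevant in the limit. The integrand splits into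
  \<open>T\<close> times \<open>\<zeta> * (Q - q)\<close>, small because \<open>T\<close> is bounded
  in L2 and the other factor tends to 0 there, and \<open>\<zeta> * q\<close> times
  \<open>T\<close>, handled by the weak limit.\<close>

lemma char_converges_on_bounded_variance:
  fixes s :: "'a \<Rightarrow> real"
  assumes s[measurable]: "s \<in> borel_measurable M"
    and lim: "AE \<omega> in M. (\<lambda>n. (\<Sum>k<n. (V k \<omega>)\<^sup>2) / real n) \<longlonglongrightarrow> s \<omega>"
    and K: "\<And>n. (\<Sum>k<n. \<integral>\<omega>. (V k \<omega>)\<^sup>2 \<partial>M) / real n \<le> K"
    and \<zeta>[measurable]: "\<zeta> \<in> borel_measurable M" and B: "\<And>\<omega>. \<bar>\<zeta> \<omega>\<bar> \<le> B"
    and C: "0 \<le> C" and supp: "\<And>\<omega>. \<zeta> \<omega> \<noteq> 0 \<Longrightarrow> s \<omega> < C"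
  shows "(\<lambda>n. \<integral>\<omega>. of_real (\<zeta> \<omega>) * cis (\<Sum>k<n. V k \<omega> / sqrt (real n)) \<partial>M)
           \<longlonglongrightarrow> of_real (\<integral>\<omega>. \<zeta> \<omega> * exp (- s \<omega> / 2) \<partial>M)"
proof -
  have B0: "0 \<le> B" using B[of undefined] by linarith
  have [measurable]: "cis \<in> borel_measurable borel"
    by (intro borel_measurable_continuous_onI continuous_intros)
  \<comment> \<open>Cutting at 0 gives \<open>q \<omega> \<le> 1\<close> at every point, whereas
    \<open>s\<close> is nonnegative only almost everywhere.\<close>
  define q where "q \<omega> = exp (- max 0 (s \<omega>) / 2)" for \<omega>
  have [measurable]: "q \<in> borel_measurable M" unfolding q_def by simp
  have q: "0 \<le> q \<omega>" "q \<omega> \<le> 1" for \<omega> by (auto simp: q_def)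
  have s0: "AE \<omega> in M. 0 \<le> s \<omega>"
    using lim by eventually_elim (rule LIMSEQ_le_const, auto intro!: divide_nonneg_nonneg sum_nonneg)
  have \<zeta>_q: "\<bar>\<zeta> \<omega> * q \<omega>\<bar> \<le> B" for \<omega>
    using mult_mono[OF B[of \<omega>] q(2)[of \<omega>] B0] q(1)[of \<omega>] by (simp add: abs_mult)
  let ?S = "\<lambda>n \<omega>. \<Sum>k<n. V k \<omega> / sqrt (real n)"
  let ?S' = "\<lambda>C n \<omega>. \<Sum>k<n. stopped C n k \<omega>"
  let ?R = "\<lambda>n \<omega>. of_real (\<zeta> \<omega>) * (Q C n \<omega> - of_real (q \<omega>))"
  have R_le: "norm (?R n \<omega>) \<le> B * 2" for n \<omega>
  proof -
    have "norm (Q C n \<omega> - of_real (q \<omega>)) \<le> 2"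
      using norm_triangle_ineq4[of "Q C n \<omega>" "of_real (q \<omega>)"] norm_Q_le[of C n \<omega>] q[of \<omega>] by simp
    then show ?thesis using B[of \<omega>] B0 by (simp only: norm_mult norm_of_real) (rule mult_mono, auto)
  qed
  have R_sq_le: "norm ((norm (?R n \<omega>))\<^sup>2) \<le> (B * 2)\<^sup>2" for n \<omega>
    using power_mono[OF R_le norm_ge_zero] by (simp only: real_norm_def abs_power2)
  have R_sq: "integrable M (\<lambda>\<omega>. (norm (?R n \<omega>))\<^sup>2)" for n
    by (rule integrable_const_bound[OF AE_I2[OF R_sq_le]]) simp
  have R_lim: "(\<lambda>n. \<integral>\<omega>. (norm (?R n \<omega>))\<^sup>2 \<partial>M) \<longlonglongrightarrow> (\<integral>\<omega>. 0 \<partial>M)"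
  proof (rule integral_dominated_convergence[where w = "\<lambda>_. (B * 2)\<^sup>2"])
    show "AE \<omega> in M. (\<lambda>n. (norm (?R n \<omega>))\<^sup>2) \<longlonglongrightarrow> 0"
      using lim s0
    proof eventually_elim
      case (elim \<omega>)
      show ?case
      proof (cases "\<zeta> \<omega> = 0")
        case False
        have "(\<lambda>n. Q C n \<omega>) \<longlonglongrightarrow> of_real (q \<omega>)"
          using Q_tendsto[OF elim(1) supp[OF False]] elim(2) by (simp add: q_def max_def)
        then have "(\<lambda>n. (norm (?R n \<omega>))\<^sup>2) \<longlonglongrightarrow> (norm (of_real (\<zeta> \<omega>) * (of_real (q \<omega>) - of_real (q \<omega>) :: complex)))\<^sup>2"
          by (intro tendsto_intros)
        then show ?thesis by simp
      qed simp
    qed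
    show "AE \<omega> in M. norm ((norm (?R n \<omega>))\<^sup>2) \<le> (B * 2)\<^sup>2" for n by (rule AE_I2[OF R_sq_le])
  qed simp_all
  have TR: "(\<lambda>n. \<integral>\<omega>. T C n n \<omega> * ?R n \<omega> \<partial>M) \<longlonglongrightarrow> 0"
  proof (rule LIMSEQ_I)
    fix r :: real assume r: "0 < r"
    define L where "L = exp C * (1 + K)"
    have L: "(\<integral>\<omega>. (norm (T C n n \<omega>))\<^sup>2 \<partial>M) \<le> L" if "0 < n" for n
      unfolding L_def by (rule T_second_moment[OF C that K])
    have L0: "0 \<le> L" using L[of 1] by (rule order_trans[rotated]) simp_all
    define d where "d = r / 4 / (L + 1)"
    have d_pos: "0 < d" using r L0 by (simp add: d_def)
    have "d * (L + 1) = r / 4" using L0 by (metis d_def eq_divide_eq add_nonneg_eq_0_iff zero_le_one zero_neq_one)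
    then have d: "0 < d" "d * L < r / 2" using d_pos r by (auto simp: distrib_left)
    have "\<forall>\<^sub>F n in sequentially. (\<integral>\<omega>. (norm (?R n \<omega>))\<^sup>2 \<partial>M) < d * (r / 2)"
      using order_tendstoD(2)[OF R_lim, of "d * (r / 2)"] d r by simp
    with eventually_gt_at_top[of 0]
    have "\<forall>\<^sub>F n in sequentially. norm (\<integral>\<omega>. T C n n \<omega> * ?R n \<omega> \<partial>M) < r"
    proof eventually_elim
      case (elim n)
      have "norm (\<integral>\<omega>. T C n n \<omega> * ?R n \<omega> \<partial>M)
          \<le> d * (\<integral>\<omega>. (norm (T C n n \<omega>))\<^sup>2 \<partial>M) + (\<integral>\<omega>. (norm (?R n \<omega>))\<^sup>2 \<partial>M) / d"
        by (rule norm_integral_mult_le) (use R_sq d T_square_integrable[OF C elim(1)] in simp_all)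
      also have "\<dots> \<le> d * L + (d * (r / 2)) / d"
        using d L[OF elim(1)] elim(2) by (intro add_mono mult_left_mono divide_right_mono) auto
      also have "\<dots> < r" using d by simp
      finally show ?case .
    qed
    then show "\<exists>N. \<forall>n\<ge>N. norm ((\<integral>\<omega>. T C n n \<omega> * ?R n \<omega> \<partial>M) - 0) < r"
      by (simp add: eventually_sequentially)
  qed
  \<comment> \<open>The random limit \<open>q\<close> of \<open>Q\<close> becomes part of the test
    function, which is merely measurable for \<open>M\<close>.\<close>
  have weak: "(\<lambda>n. \<integral>\<omega>. of_real (\<zeta> \<omega> * q \<omega>) * T C n n \<omega> \<partial>M) \<longlonglongrightarrow> of_real (\<integral>\<omega>. \<zeta> \<omega> * q \<omega> \<partial>M)"
    by (rule T_tends_weakly_to_1[OF C _ _ K, of _ B]) (use \<zeta>_q in auto)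
  have "(\<lambda>n. (\<integral>\<omega>. T C n n \<omega> * ?R n \<omega> \<partial>M) + (\<integral>\<omega>. of_real (\<zeta> \<omega> * q \<omega>) * T C n n \<omega> \<partial>M))
      \<longlonglongrightarrow> 0 + of_real (\<integral>\<omega>. \<zeta> \<omega> * q \<omega> \<partial>M)"
    by (rule tendsto_add[OF TR weak])
  moreover have "\<forall>\<^sub>F n in sequentially. (\<integral>\<omega>. T C n n \<omega> * ?R n \<omega> \<partial>M) + (\<integral>\<omega>. of_real (\<zeta> \<omega> * q \<omega>) * T C n n \<omega> \<partial>M)
      = (\<integral>\<omega>. of_real (\<zeta> \<omega>) * cis (?S' C n \<omega>) \<partial>M)"
    using eventually_gt_at_top[of 0]
  proof eventually_elim
    case (elim n)
    have i1: "integrable M (\<lambda>\<omega>. T C n n \<omega> * ?R n \<omega>)"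
      by (rule integrable_mult_square_integrable) (use R_sq T_square_integrable[OF C elim] in simp_all)
    have i2: "integrable M (\<lambda>\<omega>. of_real (\<zeta> \<omega> * q \<omega>) * T C n n \<omega>)"
      using integrable_mult_square_integrable[of "\<lambda>\<omega>. of_real (\<zeta> \<omega> * q \<omega>) * T C n n \<omega>" M "\<lambda>_. 1"]
        square_integrable_bounded_mult[OF _ _ AE_I2[OF \<zeta>_q] T_square_integrable[OF C elim]] by simp
    have "T C n n \<omega> * ?R n \<omega> + of_real (\<zeta> \<omega> * q \<omega>) * T C n n \<omega> = of_real (\<zeta> \<omega>) * cis (?S' C n \<omega>)" for \<omega>
      by (simp add: algebra_simps flip: T_Q)
    then show ?case using i1 i2 by (simp flip: Bochner_Integration.integral_add)
  qed
  ultimately have main: "(\<lambda>n. \<integral>\<omega>. of_real (\<zeta> \<omega>) * cis (?S' C n \<omega>) \<partial>M) \<longlonglongrightarrow> 0 + of_real (\<integral>\<omega>. \<zeta> \<omega> * q \<omega> \<partial>M)"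
    by (rule Lim_transform_eventually)
  have diff_le: "norm (of_real (\<zeta> \<omega>) * (cis (?S n \<omega>) - cis (?S' C n \<omega>))) \<le> B * 2" for n \<omega>
  proof -
    have "norm (cis (?S n \<omega>) - cis (?S' C n \<omega>)) \<le> 2"
      using norm_triangle_ineq4[of "cis (?S n \<omega>)" "cis (?S' C n \<omega>)"] by simp
    then show ?thesis using B[of \<omega>] B0 by (simp only: norm_mult norm_of_real) (rule mult_mono, auto)
  qed
  have "(\<lambda>n. \<integral>\<omega>. of_real (\<zeta> \<omega>) * (cis (?S n \<omega>) - cis (?S' C n \<omega>)) \<partial>M) \<longlonglongrightarrow> (\<integral>\<omega>. 0 \<partial>M)"
  proof (rule integral_dominated_convergence[where w = "\<lambda>_. B * 2"])
    show "AE \<omega> in M. (\<lambda>n. of_real (\<zeta> \<omega>) * (cis (?S n \<omega>) - cis (?S' C n \<omega>))) \<longlonglongrightarrow> 0"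
      using lim
    proof eventually_elim
      case (elim \<omega>)
      show ?case
      proof (cases "\<zeta> \<omega> = 0")
        case False
        have "\<forall>\<^sub>F n in sequentially. of_real (\<zeta> \<omega>) * (cis (?S n \<omega>) - cis (?S' C n \<omega>)) = 0"
          using eventually_not_stopped[OF elim supp[OF False]] by eventually_elim simp
        then show ?thesis by (rule tendsto_eventually)
      qed simp
    qed
  qed (use diff_le in auto)
  then have "(\<lambda>n. (\<integral>\<omega>. of_real (\<zeta> \<omega>) * (cis (?S n \<omega>) - cis (?S' C n \<omega>)) \<partial>M) + (\<integral>\<omega>. of_real (\<zeta> \<omega>) * cis (?S' C n \<omega>) \<partial>M))
      \<longlonglongrightarrow> 0 + (0 + of_real (\<integral>\<omega>. \<zeta> \<omega> * q \<omega> \<partial>M))"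
    by (intro tendsto_add main) simp
  moreover have "(\<integral>\<omega>. of_real (\<zeta> \<omega>) * (cis (?S n \<omega>) - cis (?S' C n \<omega>)) \<partial>M) + (\<integral>\<omega>. of_real (\<zeta> \<omega>) * cis (?S' C n \<omega>) \<partial>M)
      = (\<integral>\<omega>. of_real (\<zeta> \<omega>) * cis (?S n \<omega>) \<partial>M)" for n
  proof -
    have "integrable M (\<lambda>\<omega>. of_real (\<zeta> \<omega>) * (cis (?S n \<omega>) - cis (?S' C n \<omega>)))"
      by (rule integrable_const_bound[of _ "B * 2"]) (use diff_le in auto)
    moreover have "integrable M (\<lambda>\<omega>. of_real (\<zeta> \<omega>) * cis (?S' C n \<omega>))"
      by (rule integrable_const_bound[of _ B]) (use B in \<open>auto simp: norm_mult\<close>)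
    ultimately show ?thesis
      by (simp add: right_diff_distrib flip: Bochner_Integration.integral_add)
  qed
  moreover have "(\<integral>\<omega>. \<zeta> \<omega> * q \<omega> \<partial>M) = (\<integral>\<omega>. \<zeta> \<omega> * exp (- s \<omega> / 2) \<partial>M)"
    by (rule integral_cong_AE) (use s0 in \<open>auto simp: q_def max_def\<close>)
  ultimately show ?thesis by simp
qed

text \<open>Since \<open>s\<close> is finite, cutting \<open>\<zeta>\<close> off where
  \<open>s\<close> reaches a large level \<open>c\<close> changes both sides by at most
  \<open>B\<close> times the probability of that event, uniformly in \<open>n\<close>.\<close>

theorem stable_martingale_char_limit:
  fixes s :: "'a \<Rightarrow> real"
  assumes s[measurable]: "s \<in> borel_measurable M"
    and lim: "AE \<omega> in M. (\<lambda>n. (\<Sum>k<n. (V k \<omega>)\<^sup>2) / real n) \<longlonglongrightarrow> s \<omega>"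
    and K: "\<And>n. (\<Sum>k<n. \<integral>\<omega>. (V k \<omega>)\<^sup>2 \<partial>M) / real n \<le> K"
    and \<zeta>[measurable]: "\<zeta> \<in> borel_measurable M" and B: "\<And>\<omega>. \<bar>\<zeta> \<omega>\<bar> \<le> B"
  shows "(\<lambda>n. \<integral>\<omega>. of_real (\<zeta> \<omega>) * cis (\<Sum>k<n. V k \<omega> / sqrt (real n)) \<partial>M)
           \<longlonglongrightarrow> of_real (\<integral>\<omega>. \<zeta> \<omega> * exp (- s \<omega> / 2) \<partial>M)"
proof (rule LIMSEQ_I)
  fix r :: real assume r: "0 < r"
  have B0: "0 \<le> B" using B[of undefined] by linarith
  have [measurable]: "cis \<in> borel_measurable borel"
    by (intro borel_measurable_continuous_onI continuous_intros)
  have s0: "AE \<omega> in M. 0 \<le> s \<omega>"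
    using lim by eventually_elim (rule LIMSEQ_le_const, auto intro!: divide_nonneg_nonneg sum_nonneg)
  let ?S = "\<lambda>n \<omega>. \<Sum>k<n. V k \<omega> / sqrt (real n)"
  have "(\<lambda>c::nat. \<integral>\<omega>. B * indicator {\<omega>\<in>space M. real c \<le> s \<omega>} \<omega> \<partial>M) \<longlonglongrightarrow> (\<integral>\<omega>. 0 \<partial>M)"
  proof (rule integral_dominated_convergence[where w = "\<lambda>_. B"])
    show "AE \<omega> in M. (\<lambda>c::nat. B * indicator {\<omega>\<in>space M. real c \<le> s \<omega>} \<omega>) \<longlonglongrightarrow> 0"
    proof (intro AE_I2 tendsto_eventually)
      fix \<omega>
      obtain N :: nat where "s \<omega> < real N" using reals_Archimedean2 by blast
      then show "\<forall>\<^sub>F c::nat in sequentially. B * indicator {\<omega>\<in>space M. real c \<le> s \<omega>} \<omega> = 0"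
        by (intro eventually_sequentiallyI[of N]) (auto simp: indicator_def)
    qed
  qed (use B0 in \<open>auto simp: indicator_def\<close>)
  then have "\<forall>\<^sub>F c::nat in sequentially. (\<integral>\<omega>. B * indicator {\<omega>\<in>space M. real c \<le> s \<omega>} \<omega> \<partial>M) < r / 3"
    using r by (intro order_tendstoD(2)) auto
  then obtain c :: nat where c: "(\<integral>\<omega>. B * indicator {\<omega>\<in>space M. real c \<le> s \<omega>} \<omega> \<partial>M) < r / 3"
    by (auto simp: eventually_sequentially)
  define \<eta> where "\<eta> \<omega> = (if s \<omega> < real c then \<zeta> \<omega> else 0)" for \<omega>
  have [measurable]: "\<eta> \<in> borel_measurable M" unfolding \<eta>_def by measurable
  have \<eta>_B: "\<bar>\<eta> \<omega>\<bar> \<le> B" for \<omega> using B B0 by (simp add: \<eta>_def)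
  have lim_\<eta>: "(\<lambda>n. \<integral>\<omega>. of_real (\<eta> \<omega>) * cis (?S n \<omega>) \<partial>M) \<longlonglongrightarrow> of_real (\<integral>\<omega>. \<eta> \<omega> * exp (- s \<omega> / 2) \<partial>M)"
    by (rule char_converges_on_bounded_variance[OF s lim K _ \<eta>_B, where C = "real c"]) (auto simp: \<eta>_def split: if_splits)
  then obtain N where N: "\<And>n. N \<le> n \<Longrightarrow>
      norm ((\<integral>\<omega>. of_real (\<eta> \<omega>) * cis (?S n \<omega>) \<partial>M) - of_real (\<integral>\<omega>. \<eta> \<omega> * exp (- s \<omega> / 2) \<partial>M)) < r / 3"
    using LIMSEQ_D[OF lim_\<eta>, of "r / 3"] r by auto
  \<comment> \<open>Used with \<open>h\<close> the character of the sum and with \<open>h\<close>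
    the limiting exponential; the latter has norm at most 1 only almost everywhere.\<close>
  have close: "norm ((\<integral>\<omega>. of_real (\<zeta> \<omega>) * h \<omega> \<partial>M) - (\<integral>\<omega>. of_real (\<eta> \<omega>) * h \<omega> \<partial>M)) < r / 3"
    if [measurable]: "h \<in> borel_measurable M" and h: "AE \<omega> in M. norm (h \<omega>) \<le> 1" for h :: "'a \<Rightarrow> complex"
  proof -
    have i: "integrable M (\<lambda>\<omega>. of_real (\<xi> \<omega>) * h \<omega>)"
      if [measurable]: "\<xi> \<in> borel_measurable M" and \<xi>: "\<And>\<omega>. \<bar>\<xi> \<omega>\<bar> \<le> B" for \<xi>
    proof (rule integrable_const_bound[of _ "B * 1"])
      show "AE \<omega> in M. norm (of_real (\<xi> \<omega>) * h \<omega>) \<le> B * 1"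
        using h by eventually_elim (simp only: norm_mult norm_of_real, rule mult_mono, auto simp: \<xi> B0)
    qed simp
    have "norm ((\<integral>\<omega>. of_real (\<zeta> \<omega>) * h \<omega> \<partial>M) - (\<integral>\<omega>. of_real (\<eta> \<omega>) * h \<omega> \<partial>M))
        = norm (\<integral>\<omega>. of_real (\<zeta> \<omega>) * h \<omega> - of_real (\<eta> \<omega>) * h \<omega> \<partial>M)"
      using i[OF \<zeta> B] i[OF _ \<eta>_B] by simp
    also have "\<dots> \<le> (\<integral>\<omega>. norm (of_real (\<zeta> \<omega>) * h \<omega> - of_real (\<eta> \<omega>) * h \<omega>) \<partial>M)"
      by (rule integral_norm_bound)
    also have "\<dots> \<le> (\<integral>\<omega>. B * indicator {\<omega>\<in>space M. real c \<le> s \<omega>} \<omega> \<partial>M)"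
    proof (rule integral_mono_AE)
      show "AE \<omega> in M. norm (of_real (\<zeta> \<omega>) * h \<omega> - of_real (\<eta> \<omega>) * h \<omega>) \<le> B * indicator {\<omega>\<in>space M. real c \<le> s \<omega>} \<omega>"
        using h AE_space
      proof eventually_elim
        case (elim \<omega>)
        have "norm (of_real (\<zeta> \<omega>) * h \<omega>) \<le> B * 1"
          unfolding norm_mult norm_of_real using elim B B0 by (intro mult_mono) auto
        with elim show ?case by (auto simp: \<eta>_def indicator_def)
      qed
    qed (use i[OF \<zeta> B] i[OF _ \<eta>_B] in \<open>auto intro!: integrable_real_mult_indicator simp: less_top[symmetric]\<close>)
    finally show ?thesis using c by simp
  qed
  have real: "(\<integral>\<omega>. of_real (\<xi> \<omega>) * of_real (exp (- s \<omega> / 2)) \<partial>M) = (of_real (\<integral>\<omega>. \<xi> \<omega> * exp (- s \<omega> / 2) \<partial>M) :: complex)" for \<xi>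
    by (simp flip: of_real_mult)
  have "norm ((\<integral>\<omega>. of_real (\<zeta> \<omega>) * cis (?S n \<omega>) \<partial>M) - of_real (\<integral>\<omega>. \<zeta> \<omega> * exp (- s \<omega> / 2) \<partial>M)) < r" if "N \<le> n" for n
  proof -
    let ?a = "\<integral>\<omega>. of_real (\<zeta> \<omega>) * cis (?S n \<omega>) \<partial>M" and ?b = "\<integral>\<omega>. of_real (\<eta> \<omega>) * cis (?S n \<omega>) \<partial>M"
    let ?a' = "of_real (\<integral>\<omega>. \<zeta> \<omega> * exp (- s \<omega> / 2) \<partial>M) :: complex"
      and ?b' = "of_real (\<integral>\<omega>. \<eta> \<omega> * exp (- s \<omega> / 2) \<partial>M) :: complex"
    have "norm (?a - ?b) < r / 3" by (rule close) auto
    moreover have "norm (?a' - ?b') < r / 3"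
      unfolding real[symmetric] by (rule close) (use s0 in auto)
    moreover have "norm (?b - ?b') < r / 3" by (rule N[OF that])
    moreover have "norm (?a - ?a') \<le> norm (?a - ?b) + norm (?b - ?b') + norm (?a' - ?b')"
      using norm_triangle_ineq[of "?a - ?b" "?b - ?b'"] norm_triangle_ineq4[of "?a - ?b'" "?a' - ?b'"] by simp
    ultimately show ?thesis by linarith
  qed
  then show "\<exists>N. \<forall>n\<ge>N. norm ((\<integral>\<omega>. of_real (\<zeta> \<omega>) * cis (?S n \<omega>) \<partial>M) - of_real (\<integral>\<omega>. \<zeta> \<omega> * exp (- s \<omega> / 2) \<partial>M)) < r"
    by blast
qed

end

subsection \<open>Stable convergence to a Gaussian mixture\<close>

text \<open>For a fixed event, an indicator density turns the claim of stable convergence into weak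
  convergence of finite measures.\<close>

lemma integral_weighted_distr:
  fixes f :: "'b::topological_space \<Rightarrow> real"
  assumes [measurable]: "A \<in> sets M" "Z \<in> borel_measurable M" "f \<in> borel_measurable borel"
  shows "(\<integral>x. f x \<partial>distr (density M (\<lambda>\<omega>. ennreal (indicator A \<omega>))) borel Z)
       = (\<integral>\<omega>. indicator A \<omega> * f (Z \<omega>) \<partial>M)"
  by (simp add: integral_distr integral_density)

lemma subprob_space_weighted_distr:
  assumes "prob_space M" and [measurable]: "A \<in> sets M" "Z \<in> borel_measurable M"
  shows "subprob_space (distr (density M (\<lambda>\<omega>. ennreal (indicator A \<omega>))) borel Z)"
proof -
  interpret prob_space M by fact
  show ?thesis
  proof (rule subprob_spaceI)
    show "emeasure (distr (density M (\<lambda>\<omega>. ennreal (indicator A \<omega>))) borel Z)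
        (space (distr (density M (\<lambda>\<omega>. ennreal (indicator A \<omega>))) borel Z)) \<le> 1"
      by (simp add: emeasure_distr emeasure_density ennreal_indicator measure_le_1 emeasure_le_1)
  qed simp
qed

text \<open>A probability measure for every form \<open>A\<close>, so the null set where positivity
  fails requires no repair.\<close>

definition gauss_kernel :: "('i::countable \<Rightarrow> 'i \<Rightarrow> real) \<Rightarrow> ('i \<Rightarrow> real) measure" where
  "gauss_kernel A = distr white_noise borel (gauss_map A)"

lemma gauss_map_borel [measurable]: "gauss_map A \<in> borel_measurable white_noise"
  by (rule measurable_into_function_space) (simp add: gauss_map_def)

lemma prob_space_gauss_kernel: "prob_space (gauss_kernel A)"
  unfolding gauss_kernel_def by (rule prob_space.prob_space_distr[OF prob_space_white_noise gauss_map_borel])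

text \<open>One fixed noise law is transported along a map that is jointly measurable in the outcome
  and the noise.\<close>

lemma gauss_kernel_measurable:
  assumes "\<And>i j. Sig i j \<in> borel_measurable M"
  shows "(\<lambda>\<omega>. gauss_kernel (\<lambda>i j. Sig i j \<omega>)) \<in> M \<rightarrow>\<^sub>M prob_algebra borel"
proof (rule measurable_prob_algebraI)
  show "(\<lambda>\<omega>. gauss_kernel (\<lambda>i j. Sig i j \<omega>)) \<in> M \<rightarrow>\<^sub>M subprob_algebra borel"
    unfolding gauss_kernel_def
    by (rule measurable_distr2[where M = white_noise])
       (use gauss_map_measurable[of "\<lambda>\<omega> i j. Sig i j \<omega>" M] assms
        in \<open>auto simp: space_subprob_algebra prob_space_imp_subprob_space prob_space_white_noise\<close>)
qed (rule prob_space_gauss_kernel)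

lemma integral_gauss_mixture:
  fixes Sig :: "'i::countable \<Rightarrow> 'i \<Rightarrow> 'a \<Rightarrow> real" and f :: "('i \<Rightarrow> real) \<Rightarrow> real"
  assumes "prob_space M" and Sig: "\<And>i j. Sig i j \<in> borel_measurable M"
    and A[measurable]: "A \<in> sets M"
    and f[measurable]: "f \<in> borel_measurable borel" and B: "\<And>x. \<bar>f x\<bar> \<le> B"
  shows "(\<integral>(\<omega>, \<xi>). indicator A \<omega> * f (gauss_map (\<lambda>i j. Sig i j \<omega>) \<xi>) \<partial>(M \<Otimes>\<^sub>M white_noise))
       = (\<integral>\<omega>. indicator A \<omega> * (\<integral>x. f x \<partial>gauss_kernel (\<lambda>i j. Sig i j \<omega>)) \<partial>M)"
proof -
  interpret prob_space M by fact
  interpret W: prob_space white_noise by (rule prob_space_white_noise)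
  interpret P: pair_prob_space M white_noise ..
  have [measurable]: "(\<lambda>(\<omega>, \<xi>). gauss_map (\<lambda>i j. Sig i j \<omega>) \<xi>) \<in> borel_measurable (M \<Otimes>\<^sub>M white_noise)"
    by (rule gauss_map_measurable) (rule Sig)
  have "B \<ge> 0" using B[of undefined] by linarith
  have "integrable (M \<Otimes>\<^sub>M white_noise) (\<lambda>(\<omega>, \<xi>). indicator A \<omega> * f (gauss_map (\<lambda>i j. Sig i j \<omega>) \<xi>))"
    by (rule P.integrable_const_bound[of _ B]) (use B \<open>B \<ge> 0\<close> in \<open>auto simp: indicator_def case_prod_unfold\<close>)
  then have "(\<integral>(\<omega>, \<xi>). indicator A \<omega> * f (gauss_map (\<lambda>i j. Sig i j \<omega>) \<xi>) \<partial>(M \<Otimes>\<^sub>M white_noise))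
      = (\<integral>\<omega>. (\<integral>\<xi>. indicator A \<omega> * f (gauss_map (\<lambda>i j. Sig i j \<omega>) \<xi>) \<partial>white_noise) \<partial>M)"
    using P.integral_fst'[of "\<lambda>(\<omega>, \<xi>). indicator A \<omega> * f (gauss_map (\<lambda>i j. Sig i j \<omega>) \<xi>)"] by simp
  then show ?thesis by (simp add: gauss_kernel_def integral_distr)
qed

text \<open>For each event, \<open>weak_conv_from_trig\<close> compares the restricted laws of
  \<open>Z\<close> with the restricted Gaussian mixture; cosine and sine integrals are real and
  imaginary parts of the limits in \<open>char\<close>.\<close>

lemma stable_conv_gaussian:
  fixes Z :: "nat \<Rightarrow> 'a \<Rightarrow> 'i::countable \<Rightarrow> real" and Sig :: "'i \<Rightarrow> 'i \<Rightarrow> 'a \<Rightarrow> real"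
  assumes M: "prob_space M"
    and Z: "\<And>n i. (\<lambda>\<omega>. Z (Suc n) \<omega> i) \<in> borel_measurable M"
    and Z_sq: "\<And>n i. integrable M (\<lambda>\<omega>. (Z (Suc n) \<omega> i)\<^sup>2)"
    and Z_bound: "\<And>i. \<exists>K. \<forall>n. (\<integral>\<omega>. (Z (Suc n) \<omega> i)\<^sup>2 \<partial>M) \<le> K"
    and Sig: "\<And>i j. Sig i j \<in> borel_measurable M"
    and psd: "AE \<omega> in M. psd_form (\<lambda>i j. Sig i j \<omega>)"
    and char: "\<And>A J t. A \<in> sets M \<Longrightarrow> finite J \<Longrightarrow>
        (\<lambda>n. \<integral>\<omega>. of_real (indicator A \<omega>) * cis (\<Sum>j\<in>J. t j * Z (Suc n) \<omega> j) \<partial>M)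
          \<longlonglongrightarrow> of_real (\<integral>\<omega>. indicator A \<omega> * exp (- (\<Sum>i\<in>J. \<Sum>j\<in>J. t i * t j * Sig i j \<omega>) / 2) \<partial>M)"
  shows "stable_conv M Z (\<lambda>\<omega>. gauss_kernel (\<lambda>i j. Sig i j \<omega>))"
  unfolding stable_conv_def
proof (intro ballI allI impI)
  fix A and g :: "('i \<Rightarrow> real) \<Rightarrow> real"
  assume A[measurable]: "A \<in> sets M" and g: "continuous_on UNIV g" "bounded (range g)"
  interpret prob_space M by fact
  interpret W: prob_space white_noise by (rule prob_space_white_noise)
  interpret P: pair_prob_space M white_noise ..
  have [measurable]: "Z (Suc n) \<in> borel_measurable M" for n
    by (rule measurable_into_function_space[OF Z])
  have [measurable]: "(\<lambda>(\<omega>, \<xi>). gauss_map (\<lambda>i j. Sig i j \<omega>) \<xi>) \<in> borel_measurable (M \<Otimes>\<^sub>M white_noise)"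
    by (rule gauss_map_measurable) (rule Sig)
  define \<mu> where "\<mu> n = distr (density M (\<lambda>\<omega>. ennreal (indicator A \<omega>))) borel (Z (Suc n))" for n
  \<comment> \<open>The mixture is realized as the image of outcome and independent noise; Fubini
    recovers the iterated integral.\<close>
  define \<nu> where "\<nu> = distr (density (M \<Otimes>\<^sub>M white_noise) (\<lambda>p. ennreal (indicator (A \<times> space white_noise) p)))
      borel (\<lambda>(\<omega>, \<xi>). gauss_map (\<lambda>i j. Sig i j \<omega>) \<xi>)"
  have A': "A \<times> space white_noise \<in> sets (M \<Otimes>\<^sub>M white_noise)" by measurable
  have \<mu>_int: "(\<integral>x. f x \<partial>\<mu> n) = (\<integral>\<omega>. indicator A \<omega> * f (Z (Suc n) \<omega>) \<partial>M)"
    if "f \<in> borel_measurable borel" for f :: "('i \<Rightarrow> real) \<Rightarrow> real" and n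
    unfolding \<mu>_def using that by (intro integral_weighted_distr) auto
  have \<nu>_int: "(\<integral>x. f x \<partial>\<nu>) = (\<integral>\<omega>. indicator A \<omega> * (\<integral>x. f x \<partial>gauss_kernel (\<lambda>i j. Sig i j \<omega>)) \<partial>M)"
    if f[measurable]: "f \<in> borel_measurable borel" and B: "\<And>x. \<bar>f x\<bar> \<le> B" for f :: "('i \<Rightarrow> real) \<Rightarrow> real" and B
  proof -
    have "(\<integral>x. f x \<partial>\<nu>) = (\<integral>p. indicator (A \<times> space white_noise) p
        * f (case p of (\<omega>, \<xi>) \<Rightarrow> gauss_map (\<lambda>i j. Sig i j \<omega>) \<xi>) \<partial>(M \<Otimes>\<^sub>M white_noise))"
      unfolding \<nu>_def by (rule integral_weighted_distr[OF A']) auto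
    also have "\<dots> = (\<integral>(\<omega>, \<xi>). indicator A \<omega> * f (gauss_map (\<lambda>i j. Sig i j \<omega>) \<xi>) \<partial>(M \<Otimes>\<^sub>M white_noise))"
      by (intro Bochner_Integration.integral_cong) (auto simp: indicator_def space_pair_measure)
    also have "\<dots> = (\<integral>\<omega>. indicator A \<omega> * (\<integral>x. f x \<partial>gauss_kernel (\<lambda>i j. Sig i j \<omega>)) \<partial>M)"
      by (rule integral_gauss_mixture[OF M Sig A f B])
    finally show ?thesis .
  qed
  have lin_cont: "continuous_on UNIV (\<lambda>x::'i \<Rightarrow> real. \<Sum>j\<in>J. t j * x j)" for J t
    by (intro continuous_intros continuous_on_product_coordinates)
  have lin [measurable]: "(\<lambda>x::'i \<Rightarrow> real. \<Sum>j\<in>J. t j * x j) \<in> borel_measurable borel" for J t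
    by (rule borel_measurable_continuous_onI[OF lin_cont])
  have [measurable]: "cis \<in> borel_measurable borel"
    by (intro borel_measurable_continuous_onI continuous_intros)
  have kernel_char: "AE \<omega> in M. (\<integral>x. cis (\<Sum>j\<in>J. t j * x j) \<partial>gauss_kernel (\<lambda>i j. Sig i j \<omega>))
      = of_real (exp (- (\<Sum>i\<in>J. \<Sum>j\<in>J. t i * t j * Sig i j \<omega>) / 2))" if "finite J" for J t
    using psd
  proof eventually_elim
    case (elim \<omega>)
    from centered_gaussian_gauss_map[OF this] that show ?case
      unfolding gauss_kernel_def centered_gaussian_def by auto
  qed
  have kernel_int: "integrable (gauss_kernel C) (\<lambda>x. cis (\<Sum>j\<in>J. t j * x j))" for C :: "'i \<Rightarrow> 'i \<Rightarrow> real" and J t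
  proof -
    interpret K: prob_space "gauss_kernel C" by (rule prob_space_gauss_kernel)
    show ?thesis
    proof (rule K.integrable_const_bound[of _ 1])
      show "(\<lambda>x. cis (\<Sum>j\<in>J. t j * x j)) \<in> borel_measurable (gauss_kernel C)"
        unfolding gauss_kernel_def by simp
    qed simp
  qed
  have base_int: "integrable M (\<lambda>\<omega>. of_real (indicator A \<omega>) * cis (\<Sum>j\<in>J. t j * Z (Suc n) \<omega> j))" for n J t
  proof (rule integrable_const_bound[of _ 1])
    show "(\<lambda>\<omega>. of_real (indicator A \<omega>) * cis (\<Sum>j\<in>J. t j * Z (Suc n) \<omega> j)) \<in> borel_measurable M"
      using Z by measurable
  qed (auto simp: norm_mult indicator_def)
  have "(\<lambda>n. \<integral>x. g x \<partial>\<mu> n) \<longlonglongrightarrow> (\<integral>x. g x \<partial>\<nu>)"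
  proof (rule weak_conv_from_trig)
    show "subprob_space (\<mu> n)" "sets (\<mu> n) = sets borel" for n
      unfolding \<mu>_def by (auto intro: subprob_space_weighted_distr[OF M])
    show "subprob_space \<nu>" "sets \<nu> = sets borel"
      unfolding \<nu>_def by (auto intro!: subprob_space_weighted_distr[OF P.prob_space_axioms A'])
  next
    fix i and e :: real assume e: "0 < e"
    obtain K where K: "\<And>n. (\<integral>\<omega>. (Z (Suc n) \<omega> i)\<^sup>2 \<partial>M) \<le> K" using Z_bound by blast
    have K0: "0 \<le> K" using K[of 0] by (rule order_trans[rotated]) simp
    \<comment> \<open>Chebyshev radius for the second-moment bound \<open>K\<close>; adding 1 keeps
      it positive when \<open>K = 0\<close>.\<close>
    define R where "R = sqrt (K / e) + 1"
    have R: "0 < R" "K \<le> e * R\<^sup>2"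
    proof -
      show "0 < R" using e K0 by (simp add: R_def add_nonneg_pos)
      have "K / e = (sqrt (K / e))\<^sup>2" using e K0 by simp
      also have "\<dots> \<le> R\<^sup>2" unfolding R_def using e K0 by (intro power_mono) auto
      finally show "K \<le> e * R\<^sup>2" using e by (simp add: field_simps)
    qed
    have "measure (\<mu> n) {x. R < \<bar>x i\<bar>} \<le> e" for n
    proof -
      have o: "open {x :: 'i \<Rightarrow> real. R < \<bar>x i\<bar>}"
        by (intro open_Collect_less continuous_intros continuous_on_product_coordinates)
      then have ms [measurable]: "{x :: 'i \<Rightarrow> real. R < \<bar>x i\<bar>} \<in> sets borel" by simp
      have "measure (\<mu> n) {x. R < \<bar>x i\<bar>} = (\<integral>x. indicator {x. R < \<bar>x i\<bar>} x \<partial>\<mu> n)"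
        using ms by (simp add: \<mu>_def)
      also have "\<dots> = (\<integral>\<omega>. indicator A \<omega> * indicator {x. R < \<bar>x i\<bar>} (Z (Suc n) \<omega>) \<partial>M)"
        by (rule \<mu>_int) simp
      also have "\<dots> \<le> (\<integral>\<omega>. (Z (Suc n) \<omega> i)\<^sup>2 / R\<^sup>2 \<partial>M)"
      proof (rule integral_mono)
        show "integrable M (\<lambda>\<omega>. indicator A \<omega> * indicator {x. R < \<bar>x i\<bar>} (Z (Suc n) \<omega>) :: real)"
        proof (rule integrable_const_bound[of _ 1])
          show "(\<lambda>\<omega>. indicator A \<omega> * indicator {x. R < \<bar>x i\<bar>} (Z (Suc n) \<omega>) :: real) \<in> borel_measurable M"
            by measurable
        qed (auto simp: indicator_def)
        show "integrable M (\<lambda>\<omega>. (Z (Suc n) \<omega> i)\<^sup>2 / R\<^sup>2)" using Z_sq by simp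
        fix \<omega>
        have "1 \<le> (Z (Suc n) \<omega> i)\<^sup>2 / R\<^sup>2" if "R < \<bar>Z (Suc n) \<omega> i\<bar>"
          using that R(1) power_mono[of R "\<bar>Z (Suc n) \<omega> i\<bar>" 2] by (simp add: le_divide_eq)
        then show "indicator A \<omega> * indicator {x. R < \<bar>x i\<bar>} (Z (Suc n) \<omega>) \<le> (Z (Suc n) \<omega> i)\<^sup>2 / R\<^sup>2"
          by (auto simp: indicator_def)
      qed
      also have "\<dots> \<le> K / R\<^sup>2" using K R(1) by (simp add: divide_right_mono)
      also have "\<dots> \<le> e" using R by (simp add: divide_le_eq)
      finally show ?thesis .
    qed
    then show "\<exists>R. \<forall>n. measure (\<mu> n) {x. R < \<bar>x i\<bar>} \<le> e" by blast
  next
    fix J :: "'i set" and t :: "'i \<Rightarrow> real" assume J: "finite J"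
    let ?q = "\<lambda>\<omega>. exp (- (\<Sum>i\<in>J. \<Sum>j\<in>J. t i * t j * Sig i j \<omega>) / 2)"
    have Sig_meas [measurable]: "?q \<in> borel_measurable M" using Sig by measurable
    note lim = char[OF A J, of t]
    have "(\<integral>x. cos (\<Sum>j\<in>J. t j * x j) \<partial>\<nu>)
        = (\<integral>\<omega>. indicator A \<omega> * (\<integral>x. cos (\<Sum>j\<in>J. t j * x j) \<partial>gauss_kernel (\<lambda>i j. Sig i j \<omega>)) \<partial>M)"
      by (rule \<nu>_int[of _ 1]) auto
    also have "\<dots> = (\<integral>\<omega>. indicator A \<omega> * ?q \<omega> \<partial>M)"
    proof (rule Bochner_Integration.integral_cong_AE)
      show AE: "AE \<omega> in M. indicator A \<omega> * (\<integral>x. cos (\<Sum>j\<in>J. t j * x j) \<partial>gauss_kernel (\<lambda>i j. Sig i j \<omega>))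
          = indicator A \<omega> * ?q \<omega>"
        using kernel_char[OF J, of t]
      proof eventually_elim
        case (elim \<omega>)
        from arg_cong[OF this, of Re] show ?case
          using kernel_int by (simp flip: integral_Re)
      qed
      show "(\<lambda>\<omega>. indicator A \<omega> * (\<integral>x. cos (\<Sum>j\<in>J. t j * x j) \<partial>gauss_kernel (\<lambda>i j. Sig i j \<omega>))) \<in> borel_measurable M"
        using measurable_compose[OF measurable_prob_algebraD[OF gauss_kernel_measurable[OF Sig]]
            integral_measurable_subprob_algebra[of "\<lambda>x. cos (\<Sum>j\<in>J. t j * x j)"]] by simp
      show "(\<lambda>\<omega>. indicator A \<omega> * ?q \<omega>) \<in> borel_measurable M"
        by (intro borel_measurable_times borel_measurable_indicator A Sig_meas)
    qed
    also have "\<dots> = Re (of_real (\<integral>\<omega>. indicator A \<omega> * ?q \<omega> \<partial>M))" by simp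
    finally show "(\<lambda>n. \<integral>x. cos (\<Sum>j\<in>J. t j * x j) \<partial>\<mu> n) \<longlonglongrightarrow> (\<integral>x. cos (\<Sum>j\<in>J. t j * x j) \<partial>\<nu>)"
      using tendsto_Re[OF lim] base_int by (simp add: \<mu>_int flip: integral_Re)
    \<comment> \<open>The centered Gaussian characteristic function is real, so its sine part
      vanishes.\<close>
    have "(\<integral>x. sin (\<Sum>j\<in>J. t j * x j) \<partial>\<nu>)
        = (\<integral>\<omega>. indicator A \<omega> * (\<integral>x. sin (\<Sum>j\<in>J. t j * x j) \<partial>gauss_kernel (\<lambda>i j. Sig i j \<omega>)) \<partial>M)"
      by (rule \<nu>_int[of _ 1]) auto
    also have "\<dots> = 0"
    proof (rule integral_eq_zero_AE)
      show "AE \<omega> in M. indicator A \<omega> * (\<integral>x. sin (\<Sum>j\<in>J. t j * x j) \<partial>gauss_kernel (\<lambda>i j. Sig i j \<omega>)) = 0"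
        using kernel_char[OF J, of t]
      proof eventually_elim
        case (elim \<omega>)
        from arg_cong[OF this, of Im] show ?case
          using kernel_int by (simp flip: integral_Im)
      qed
    qed
    finally show "(\<lambda>n. \<integral>x. sin (\<Sum>j\<in>J. t j * x j) \<partial>\<mu> n) \<longlonglongrightarrow> (\<integral>x. sin (\<Sum>j\<in>J. t j * x j) \<partial>\<nu>)"
      using tendsto_Im[OF lim] base_int by (simp add: \<mu>_int flip: integral_Im)
  qed (rule g)+
  moreover obtain B where B: "\<And>x. \<bar>g x\<bar> \<le> B" using g(2) by (auto simp: bounded_iff)
  ultimately show "(\<lambda>n. \<integral>\<omega>. indicator A \<omega> * g (Z (Suc n) \<omega>) \<partial>M)
      \<longlonglongrightarrow> (\<integral>\<omega>. indicator A \<omega> * (\<integral>x. g x \<partial>gauss_kernel (\<lambda>i j. Sig i j \<omega>)) \<partial>M)"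
    using borel_measurable_continuous_onI[OF g(1)] by (simp add: \<mu>_int \<nu>_int[OF _ B])
qed

subsection \<open>Partially conditionally identically distributed arrays\<close>

text \<open>Pythagoras: the cross terms vanish by orthogonality. A bound on the normalized sums
  thereby becomes the bound \<open>K\<close> on averaged second moments.\<close>

lemma (in martingale_differences) sum_second_moment:
  "(\<integral>\<omega>. (\<Sum>k<n. V k \<omega>)\<^sup>2 \<partial>M) = (\<Sum>k<n. \<integral>\<omega>. (V k \<omega>)\<^sup>2 \<partial>M) \<and> integrable M (\<lambda>\<omega>. (\<Sum>k<n. V k \<omega>)\<^sup>2)"
proof (induction n)
  case (Suc n)
  let ?Y = "\<lambda>\<omega>. \<Sum>k<n. V k \<omega>"
  have Y_G: "?Y \<in> borel_measurable (G n)"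
    using V_adapted' by (intro borel_measurable_sum) auto
  have int: "integrable M (\<lambda>\<omega>. ?Y \<omega> * V n \<omega>)"
    using Suc V_square by (intro integrable_mult_square_integrable) auto
  have sq: "(\<Sum>k<Suc n. V k \<omega>)\<^sup>2 = (?Y \<omega>)\<^sup>2 + (V n \<omega>)\<^sup>2 + 2 * (?Y \<omega> * V n \<omega>)" for \<omega>
    by (simp add: power2_sum)
  show ?case
    unfolding sq using Suc int V_square V_orth[OF Y_G] by simp
qed simp

lemma subalgebra_Gj:
  assumes F: "is_filtration M G" and X: "\<And>i. X (Suc n) i \<in> borel_measurable M"
  shows "subalgebra M (Gj M G X n j)" and "sets (G n) \<subseteq> sets (Gj M G X n j)"
proof -
  let ?E = "sets (G n) \<union> (\<Union>i\<in>{i. i \<noteq> j}. {X (Suc n) i -` B \<inter> space M | B. B \<in> sets borel})"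
  have E: "?E \<subseteq> sets M"
    using F X by (auto simp: is_filtration_def subalgebra_def intro: measurable_sets)
  then have "?E \<subseteq> Pow (space M)" using sets.sets_into_space by blast
  then have S: "sets (Gj M G X n j) = sigma_sets (space M) ?E" "space (Gj M G X n j) = space M"
    unfolding Gj_def by (simp_all only: sets_measure_of space_measure_of)
  show "subalgebra M (Gj M G X n j)"
    using S sets.sigma_sets_subset[OF E] by (simp add: subalgebra_def)
  show "sets (G n) \<subseteq> sets (Gj M G X n j)"
    unfolding S by (auto intro: sigma_sets.Basic)
qed

text \<open>Equality of conditional laws is given for bounded functions only, so the identity is
  truncated at level \<open>m\<close> and dominated convergence removes the truncation. Events of
  \<open>G n\<close> lie in \<open>Gj\<close>, where conditional expectations may be integrated over
  them.\<close>

lemma cid_set_integral: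
  assumes M: "prob_space M" and F: "is_filtration M G" and cid: "partially_cid M G X"
    and X: "\<And>n i. n \<ge> 1 \<Longrightarrow> integrable M (X n i)" and k: "k \<ge> 1" and A: "A \<in> sets (G n)"
  shows "(\<integral>\<omega>\<in>A. X (Suc n) j \<omega> \<partial>M) = (\<integral>\<omega>\<in>A. X (n + k) j \<omega> \<partial>M)"
proof -
  interpret prob_space M by fact
  have Xm [measurable]: "X (Suc m) i \<in> borel_measurable M" for m i using X[of "Suc m" i] by auto
  have Xk: "integrable M (X (n + k) j)" "integrable M (X (Suc n) j)" using X k by auto
  then have [measurable]: "X (n + k) j \<in> borel_measurable M" by auto
  note sub = subalgebra_Gj[OF F, of X n, OF Xm, of j]
  have A': "A \<in> sets (Gj M G X n j)" using sub(2) A by blast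
  then have [measurable]: "A \<in> sets M" using sub(1) by (auto simp: subalgebra_def)
  interpret S: sigma_finite_subalgebra M "Gj M G X n j"
    by (rule finite_measure_subalgebra_is_sigma_finite, unfold_locales, rule sub(1))
  define f where "f m x = max (- real m) (min (real m) x)" for m and x :: real
  have f_meas [measurable]: "f m \<in> borel_measurable borel" for m unfolding f_def by simp
  have f_le: "\<bar>f m x\<bar> \<le> real m" "\<bar>f m x\<bar> \<le> \<bar>x\<bar>" for m x by (auto simp: f_def)
  have eq: "(\<integral>\<omega>\<in>A. f m (X (Suc n) j \<omega>) \<partial>M) = (\<integral>\<omega>\<in>A. f m (X (n + k) j \<omega>) \<partial>M)" for m
  proof -
    have int: "integrable M (\<lambda>\<omega>. f m (Y \<omega>))" if "Y \<in> borel_measurable M" for Y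
      by (rule integrable_const_bound[of _ "real m"]) (use f_le that in auto)
    have "bounded (range (f m))" using f_le(1) by (auto simp: bounded_iff)
    then have "AE \<omega> in M. real_cond_exp M (Gj M G X n j) (\<lambda>x. f m (X (Suc n) j x)) \<omega>
                   = real_cond_exp M (Gj M G X n j) (\<lambda>x. f m (X (n + k) j x)) \<omega>"
      using cid k f_meas unfolding partially_cid_def by blast
    then have "(\<integral>\<omega>\<in>A. real_cond_exp M (Gj M G X n j) (\<lambda>x. f m (X (Suc n) j x)) \<omega> \<partial>M)
        = (\<integral>\<omega>\<in>A. real_cond_exp M (Gj M G X n j) (\<lambda>x. f m (X (n + k) j x)) \<omega> \<partial>M)"
      unfolding set_lebesgue_integral_def by (intro integral_cong_AE) auto
    then show ?thesis
      using S.real_cond_exp_intA[OF int A'] by simp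
  qed
  have lim: "(\<lambda>m. \<integral>\<omega>\<in>A. f m (Y \<omega>) \<partial>M) \<longlonglongrightarrow> (\<integral>\<omega>\<in>A. Y \<omega> \<partial>M)" if Y: "integrable M Y" for Y
    unfolding set_lebesgue_integral_def
  proof (rule integral_dominated_convergence)
    show "integrable M (\<lambda>\<omega>. \<bar>Y \<omega>\<bar>)" using Y by simp
    have [measurable]: "Y \<in> borel_measurable M" using Y by auto
    show "(\<lambda>\<omega>. indicator A \<omega> *\<^sub>R Y \<omega>) \<in> borel_measurable M"
      "(\<lambda>\<omega>. indicator A \<omega> *\<^sub>R f m (Y \<omega>)) \<in> borel_measurable M" for m by measurable
    show "AE \<omega> in M. (\<lambda>m. indicator A \<omega> *\<^sub>R f m (Y \<omega>)) \<longlonglongrightarrow> indicator A \<omega> *\<^sub>R Y \<omega>"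
    proof (rule AE_I2)
      fix \<omega>
      obtain N :: nat where "\<bar>Y \<omega>\<bar> \<le> real N" using real_arch_simple by blast
      then have "\<forall>\<^sub>F m in sequentially. indicator A \<omega> *\<^sub>R f m (Y \<omega>) = indicator A \<omega> *\<^sub>R Y \<omega>"
        by (intro eventually_sequentiallyI[of N]) (auto simp: f_def)
      then show "(\<lambda>m. indicator A \<omega> *\<^sub>R f m (Y \<omega>)) \<longlonglongrightarrow> indicator A \<omega> *\<^sub>R Y \<omega>"
        by (rule tendsto_eventually)
    qed
    show "AE \<omega> in M. norm (indicator A \<omega> *\<^sub>R f m (Y \<omega>)) \<le> \<bar>Y \<omega>\<bar>" for m
      using f_le(2) by (auto simp: indicator_def)
  qed
  show ?thesis
    using LIMSEQ_unique[OF lim[OF Xk(2)]] lim[OF Xk(1)] eq by simp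
qed

text \<open>The quadratic form of the averaged products is an average of squares; nonnegativity and
  symmetry pass to the limit.\<close>

lemma psd_form_limit:
  fixes v :: "nat \<Rightarrow> 'i \<Rightarrow> real"
  assumes lim: "\<And>i j. (\<lambda>n. (\<Sum>k<n. v k i * v k j) / real n) \<longlonglongrightarrow> C i j"
  shows "finite J \<Longrightarrow> (\<lambda>n. (\<Sum>k<n. (\<Sum>j\<in>J. t j * v k j)\<^sup>2) / real n) \<longlonglongrightarrow> (\<Sum>i\<in>J. \<Sum>j\<in>J. t i * t j * C i j)"
    and "psd_form C"
proof -
  have quad: "(\<lambda>n. (\<Sum>k<n. (\<Sum>j\<in>J. t j * v k j)\<^sup>2) / real n) \<longlonglongrightarrow> (\<Sum>i\<in>J. \<Sum>j\<in>J. t i * t j * C i j)" for J t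
  proof -
    have "(\<Sum>k<n. (\<Sum>j\<in>J. t j * v k j)\<^sup>2) / real n
        = (\<Sum>i\<in>J. \<Sum>j\<in>J. t i * t j * ((\<Sum>k<n. v k i * v k j) / real n))" for n
    proof -
      have "(\<Sum>k<n. (\<Sum>j\<in>J. t j * v k j)\<^sup>2) = (\<Sum>k<n. \<Sum>i\<in>J. \<Sum>j\<in>J. t i * t j * (v k i * v k j))"
        by (simp add: power2_eq_square sum_product algebra_simps)
      also have "\<dots> = (\<Sum>i\<in>J. \<Sum>j\<in>J. \<Sum>k<n. t i * t j * (v k i * v k j))"
        by (subst sum.swap, intro sum.cong refl, subst sum.swap) simp
      finally show ?thesis by (simp add: sum_distrib_left sum_divide_distrib)
    qed
    then show ?thesis by (simp only:) (intro tendsto_sum tendsto_mult tendsto_const lim)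
  qed
  then show "(\<lambda>n. (\<Sum>k<n. (\<Sum>j\<in>J. t j * v k j)\<^sup>2) / real n) \<longlonglongrightarrow> (\<Sum>i\<in>J. \<Sum>j\<in>J. t i * t j * C i j)" .
  have "C i j = C j i" for i j
    using LIMSEQ_unique[OF lim[of i j]] lim[of j i] by (simp add: mult.commute)
  moreover have "0 \<le> (\<Sum>i\<in>J. \<Sum>j\<in>J. t i * t j * C i j)" for J t
    by (rule LIMSEQ_le_const[OF quad]) (auto intro!: divide_nonneg_nonneg sum_nonneg)
  ultimately show "psd_form C" unfolding psd_form_def by blast
qed

text \<open>The witness is \<open>gauss_kernel\<close> applied to \<open>Sig\<close>, whose
  positivity is derived from the convergence of the averages.\<close>

theorem mainTheorem15:
  fixes M :: "'a measure" and G :: "nat \<Rightarrow> 'a measure"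
    and X :: "nat \<Rightarrow> 'i::countable \<Rightarrow> 'a \<Rightarrow> real"
    and Sig :: "'i \<Rightarrow> 'i \<Rightarrow> 'a \<Rightarrow> real"
    and S U dE V :: "nat \<Rightarrow> 'i \<Rightarrow> 'a \<Rightarrow> real"
  assumes "prob_space M"
    and "is_filtration M G"
    and "partially_cid M G X"
    and "\<And>n i. n \<ge> 1 \<Longrightarrow> X n i \<in> borel_measurable M"
    and "\<And>n i. n \<ge> 1 \<Longrightarrow> integrable M (\<lambda>\<omega>. (X n i \<omega>)\<^sup>2)"
    and S_def: "\<And>n i. S n i = (\<lambda>\<omega>. sqrt (real n) *
          ((\<Sum>k\<in>{1..n}. X k i \<omega>) / real n - real_cond_exp M (G n) (X (Suc n) i) \<omega>))"
    and U_def: "\<And>n i. U n i = (\<lambda>\<omega>. X n i \<omega> - real_cond_exp M (G (n - 1)) (X n i) \<omega>)"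
    and dE_def: "\<And>n i. dE n i = (\<lambda>\<omega>. real_cond_exp M (G n) (X (Suc n) i) \<omega>
                                     - real_cond_exp M (G (n - 1)) (X n i) \<omega>)"
    and V_def: "\<And>n i. V n i = (\<lambda>\<omega>. U n i \<omega> - real n * dE n i \<omega>)"
    and "\<And>i. (SUP n\<in>{1..}. \<integral>\<^sup>+\<omega>. ennreal ((S n i \<omega>)\<^sup>2) \<partial>M) < \<infinity>"
    and "\<And>i j. Sig i j \<in> borel_measurable M"
    and "\<And>i j. AE \<omega> in M.
           (\<lambda>n. (\<Sum>k\<in>{1..n}. V k i \<omega> * V k j \<omega>) / real n) \<longlonglongrightarrow> Sig i j \<omega>"
  shows "\<exists>\<beta>. \<beta> \<in> M \<rightarrow>\<^sub>M prob_algebra (borel :: ('i \<Rightarrow> real) measure)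
           \<and> (AE \<omega> in M. centered_gaussian (\<beta> \<omega>) (\<lambda>i j. Sig i j \<omega>))
           \<and> stable_conv M (\<lambda>n \<omega>. (\<lambda>i. S n i \<omega>)) \<beta>"
proof -
  interpret prob_space M by fact
  note F = assms(2) and cid = assms(3) and Sig = assms(11)
  have subalg: "subalgebra M (G n)" for n using F by (simp add: is_filtration_def)
  have sub: "sigma_finite_subalgebra M (G n)" for n
    by (rule finite_measure_subalgebra_is_sigma_finite, unfold_locales, rule subalg)
  have G_mono: "f \<in> borel_measurable (G n) \<Longrightarrow> n \<le> m \<Longrightarrow> f \<in> borel_measurable (G m)" for f :: "'a \<Rightarrow> real" and n m
    using F by (intro measurable_from_subalg[of "G m" "G n"]) (auto simp: is_filtration_def subalgebra_def)
  have X_int: "integrable M (X n i)" if "n \<ge> 1" for n i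
    using square_integrable_imp_integrable[OF assms(4)[OF that] assms(5)[OF that]] .
  have X_adapted: "X (Suc n) i \<in> borel_measurable (G (Suc n))" for n i
    using cid by (simp add: partially_cid_def)
  \<comment> \<open>Predictive means; \<open>D\<close> below is \<open>V\<close> shifted by one, to
    match the indexing of \<open>martingale_differences\<close>.\<close>
  define Z where "Z n i = real_cond_exp M (G n) (X (Suc n) i)" for n i
  define D where "D k i = V (Suc k) i" for k i
  have D: "D k i \<omega> = X (Suc k) i \<omega> - Z k i \<omega> - real (Suc k) * (Z (Suc k) i \<omega> - Z k i \<omega>)" for k i \<omega>
    by (simp add: D_def V_def U_def dE_def Z_def)
  have Z_G: "Z n i \<in> borel_measurable (G n)" for n i unfolding Z_def by simp
  have Z_int: "integrable M (Z n i)" for n i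
    unfolding Z_def using sigma_finite_subalgebra.real_cond_exp_int(1)[OF sub X_int] by simp
  have D_adapted: "D k i \<in> borel_measurable (G (Suc k))" for k i
  proof -
    note [measurable] = G_mono[OF Z_G, of k "Suc k"] Z_G[of "Suc k"] X_adapted[of k]
    have "(\<lambda>\<omega>. X (Suc k) i \<omega> - Z k i \<omega> - real (Suc k) * (Z (Suc k) i \<omega> - Z k i \<omega>)) \<in> borel_measurable (G (Suc k))"
      by measurable
    then show ?thesis by (simp add: D[abs_def])
  qed
  have D_meas [measurable]: "D k i \<in> borel_measurable M" for k i
    using measurable_from_subalg[OF subalg D_adapted] .
  have D_int: "integrable M (D k i)" for k i
    unfolding D[abs_def] using X_int Z_int by simp
  \<comment> \<open>Given \<open>G k\<close>, both \<open>X (Suc k) i\<close> and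
    \<open>Z (Suc k) i\<close> have conditional mean \<open>Z k i\<close>: the first by definition,
    the second by the tower property and partial c.i.d. at lag 2.\<close>
  have D_cond: "AE \<omega> in M. real_cond_exp M (G k) (D k i) \<omega> = 0" for k i
  proof (rule sigma_finite_subalgebra.real_cond_exp_charact[OF sub])
    fix A assume A: "A \<in> sets (G k)"
    then have A_Suc: "A \<in> sets (G (Suc k))"
      using F unfolding is_filtration_def by (meson le_SucI order_refl subsetD)
    have A_M: "A \<in> sets M"
      using A F by (auto simp: is_filtration_def subalgebra_def)
    have set_int: "set_integrable M A f" if "integrable M f" for f :: "'a \<Rightarrow> real"
      unfolding set_integrable_def using that A_M by (rule integrable_mult_indicator[rotated])
    have Z_A: "(\<integral>\<omega>\<in>A. Z n i \<omega> \<partial>M) = (\<integral>\<omega>\<in>A. X (Suc n) i \<omega> \<partial>M)" if "A \<in> sets (G n)" for n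
      unfolding Z_def using sigma_finite_subalgebra.real_cond_exp_intA[OF sub X_int that] by simp
    have "(\<integral>\<omega>\<in>A. X (Suc k) i \<omega> \<partial>M) = (\<integral>\<omega>\<in>A. X (Suc (Suc k)) i \<omega> \<partial>M)"
      using cid_set_integral[OF assms(1) F cid X_int _ A, of 2 i] by simp
    then have ZZ: "(\<integral>\<omega>\<in>A. Z (Suc k) i \<omega> \<partial>M) = (\<integral>\<omega>\<in>A. Z k i \<omega> \<partial>M)"
      "(\<integral>\<omega>\<in>A. Z k i \<omega> \<partial>M) = (\<integral>\<omega>\<in>A. X (Suc k) i \<omega> \<partial>M)"
      using Z_A[OF A] Z_A[OF A_Suc] by simp_all
    have "(\<integral>\<omega>\<in>A. D k i \<omega> \<partial>M) = (\<integral>\<omega>\<in>A. X (Suc k) i \<omega> \<partial>M) - (\<integral>\<omega>\<in>A. Z k i \<omega> \<partial>M)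
        - real (Suc k) * ((\<integral>\<omega>\<in>A. Z (Suc k) i \<omega> \<partial>M) - (\<integral>\<omega>\<in>A. Z k i \<omega> \<partial>M))"
      unfolding D using set_int X_int Z_int
      by (simp add: set_integral_diff)
    then show "(\<integral>\<omega>\<in>A. D k i \<omega> \<partial>M) = (\<integral>\<omega>\<in>A. 0 \<partial>M)"
      using ZZ by (simp add: set_lebesgue_integral_def)
  qed (use D_int in auto)
  \<comment> \<open>The weights \<open>Suc k\<close> telescope by summation by parts: the
    \<open>Z\<close> terms collapse to \<open>- real n * Z n i \<omega>\<close>.\<close>
  have S_sum: "S n i \<omega> = (\<Sum>k<n. D k i \<omega>) / sqrt (real n)" for n i \<omega>
  proof -
    have "(\<Sum>k<n. D k i \<omega>) = (\<Sum>k<n. X (Suc k) i \<omega>) - real n * Z n i \<omega>"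
      by (induction n) (simp_all add: D algebra_simps)
    also have "(\<Sum>k<n. X (Suc k) i \<omega>) = (\<Sum>k\<in>{1..n}. X k i \<omega>)"
      by (simp add: sum.atLeast1_atMost_eq)
    finally have sum: "(\<Sum>k\<in>{1..n}. X k i \<omega>) = (\<Sum>k<n. D k i \<omega>) + real n * Z n i \<omega>" by simp
    show ?thesis
    proof (cases "n = 0")
      case False
      then have "S n i \<omega> = sqrt (real n) * ((\<Sum>k<n. D k i \<omega>) / (sqrt (real n) * sqrt (real n)))"
        unfolding S_def Z_def[symmetric] sum by (simp add: add_divide_distrib)
      then show ?thesis using False by (simp del: real_sqrt_mult_self)
    qed (simp add: S_def)
  qed
  have S_meas [measurable]: "S n i \<in> borel_measurable M" for n i
    by (simp add: S_sum[abs_def])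
  \<comment> \<open>The supremum starts at 1; at index 0 the sum is empty and \<open>S\<close>
    vanishes.\<close>
  have S_sq: "integrable M (\<lambda>\<omega>. (S n i \<omega>)\<^sup>2)" and S_bound: "\<exists>K. \<forall>n. (\<integral>\<omega>. (S n i \<omega>)\<^sup>2 \<partial>M) \<le> K" for n i
  proof -
    obtain K where K: "(SUP n\<in>{1..}. \<integral>\<^sup>+\<omega>. ennreal ((S n i \<omega>)\<^sup>2) \<partial>M) = ennreal K" "0 \<le> K"
      using assms(10)[of i] unfolding infinity_ennreal_def less_top_ennreal by blast
    have le: "(\<integral>\<^sup>+\<omega>. ennreal ((S n i \<omega>)\<^sup>2) \<partial>M) \<le> ennreal K" for n
    proof (cases "n = 0")
      case False
      then show ?thesis unfolding K(1)[symmetric] by (intro SUP_upper) auto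
    qed (simp add: S_sum)
    show int: "integrable M (\<lambda>\<omega>. (S n i \<omega>)\<^sup>2)" for n
      using le[of n] by (intro integrableI_bounded) (auto simp: le_less_trans)
    have "(\<integral>\<omega>. (S n i \<omega>)\<^sup>2 \<partial>M) \<le> K" for n
      using le[of n] K(2) nn_integral_eq_integral[OF int[of n]] by simp
    then show "\<exists>K. \<forall>n. (\<integral>\<omega>. (S n i \<omega>)\<^sup>2 \<partial>M) \<le> K" by blast
  qed
  \<comment> \<open>\<open>D k i\<close> is the difference of two consecutive unnormalized sums, so
    the bound on \<open>S\<close> settles its square integrability.\<close>
  have D_sq: "integrable M (\<lambda>\<omega>. (D k i \<omega>)\<^sup>2)" for k i
  proof (rule Bochner_Integration.integrable_bound)
    show "integrable M (\<lambda>\<omega>. 2 * (sqrt (real (Suc k)) * S (Suc k) i \<omega>)\<^sup>2 + 2 * (sqrt (real k) * S k i \<omega>)\<^sup>2)"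
      using S_sq by (simp add: power_mult_distrib)
    have "D k i \<omega> = sqrt (real (Suc k)) * S (Suc k) i \<omega> - sqrt (real k) * S k i \<omega>" for \<omega>
      by (cases "k = 0") (simp_all add: S_sum)
    moreover have "(a - b)\<^sup>2 \<le> 2 * a\<^sup>2 + 2 * b\<^sup>2" for a b :: real
      using zero_le_power2[of "a + b"] by (simp add: power2_eq_square algebra_simps)
    ultimately show "AE \<omega> in M. norm ((D k i \<omega>)\<^sup>2)
        \<le> norm (2 * (sqrt (real (Suc k)) * S (Suc k) i \<omega>)\<^sup>2 + 2 * (sqrt (real k) * S k i \<omega>)\<^sup>2)"
      by (metis (no_types, lifting) AE_I2 abs_ge_self abs_power2 order_trans real_norm_def)
  qed simp
  have D_orth: "(\<integral>\<omega>. Y \<omega> * D k i \<omega> \<partial>M) = 0 \<and> integrable M (\<lambda>\<omega>. Y \<omega> * D k i \<omega>)"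
    if Y: "Y \<in> borel_measurable (G k)" "integrable M (\<lambda>\<omega>. (Y \<omega>)\<^sup>2)" for Y k i
  proof -
    have [measurable]: "Y \<in> borel_measurable M" by (rule measurable_from_subalg[OF subalg Y(1)])
    have int: "integrable M (\<lambda>\<omega>. Y \<omega> * D k i \<omega>)"
      using Y(2) D_sq by (intro integrable_mult_square_integrable) auto
    have "(\<integral>\<omega>. Y \<omega> * D k i \<omega> \<partial>M) = (\<integral>\<omega>. Y \<omega> * real_cond_exp M (G k) (D k i) \<omega> \<partial>M)"
      using sigma_finite_subalgebra.real_cond_exp_intg(2)[OF sub int Y(1)] by simp
    also have "\<dots> = 0"
      by (rule integral_eq_zero_AE) (use D_cond[of k i] in eventually_elim, simp)
    finally show ?thesis using int by simp
  qed
  \<comment> \<open>Countably many index pairs allow one common null set.\<close>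
  have lim: "AE \<omega> in M. \<forall>i j. (\<lambda>n. (\<Sum>k<n. D k i \<omega> * D k j \<omega>) / real n) \<longlonglongrightarrow> Sig i j \<omega>"
    unfolding AE_all_countable using assms(12) by (simp add: D_def sum.atLeast1_atMost_eq)
  have psd: "AE \<omega> in M. psd_form (\<lambda>i j. Sig i j \<omega>)"
    using lim
  proof eventually_elim
    case (elim \<omega>)
    then show ?case by (intro psd_form_limit(2)[of "\<lambda>k i. D k i \<omega>"]) auto
  qed
  have char: "(\<lambda>n. \<integral>\<omega>. of_real (indicator A \<omega>) * cis (\<Sum>j\<in>J. t j * S (Suc n) j \<omega>) \<partial>M)
      \<longlonglongrightarrow> of_real (\<integral>\<omega>. indicator A \<omega> * exp (- (\<Sum>i\<in>J. \<Sum>j\<in>J. t i * t j * Sig i j \<omega>) / 2) \<partial>M)"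
    if A: "A \<in> sets M" and J: "finite J" for A J t
  proof -
    \<comment> \<open>Cramer-Wold: a fixed linear combination of the coordinates is again a
      martingale difference sequence.\<close>
    define W where "W k \<omega> = (\<Sum>j\<in>J. t j * D k j \<omega>)" for k \<omega>
    interpret W: martingale_differences M G W
    proof
      show "is_filtration M G" by fact
      show "W k \<in> borel_measurable (G (Suc k))" for k
        unfolding W_def using D_adapted by (intro borel_measurable_sum borel_measurable_times) auto
      show "integrable M (\<lambda>\<omega>. (W k \<omega>)\<^sup>2)" for k
        unfolding W_def power2_eq_square sum_product
        using integrable_mult_square_integrable[of "D k _" M "D k _"] D_sq
        by (intro Bochner_Integration.integrable_sum) (auto simp: mult.assoc mult.left_commute)
      show "(\<integral>\<omega>. Y \<omega> * W k \<omega> \<partial>M) = 0"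
        if "Y \<in> borel_measurable (G k)" "integrable M (\<lambda>\<omega>. (Y \<omega>)\<^sup>2)" for k Y
      proof -
        have "Y \<omega> * W k \<omega> = (\<Sum>j\<in>J. t j * (Y \<omega> * D k j \<omega>))" for \<omega>
          by (simp add: W_def sum_distrib_left mult.left_commute)
        then show ?thesis using D_orth[OF that] by simp
      qed
    qed
    have W_S: "(\<Sum>k<n. W k \<omega> / sqrt (real n)) = (\<Sum>j\<in>J. t j * S n j \<omega>)" for n \<omega>
      unfolding W_def S_sum sum_divide_distrib sum_distrib_left
      by (subst sum.swap) simp
    obtain K where K: "\<And>i n. (\<integral>\<omega>. (S n i \<omega>)\<^sup>2 \<partial>M) \<le> K i" using S_bound by metis
    \<comment> \<open>Orthogonality identifies the left side with the second moment of the combined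
      \<open>S n\<close>; Cauchy-Schwarz over \<open>J\<close> yields the factor
      \<open>card J\<close>.\<close>
    have bound: "(\<Sum>k<n. \<integral>\<omega>. (W k \<omega>)\<^sup>2 \<partial>M) / real n \<le> (\<Sum>j\<in>J. (t j)\<^sup>2 * K j) * card J" for n
    proof -
      have "(\<Sum>k<n. \<integral>\<omega>. (W k \<omega>)\<^sup>2 \<partial>M) / real n = (\<integral>\<omega>. (\<Sum>k<n. W k \<omega>)\<^sup>2 / real n \<partial>M)"
        using W.sum_second_moment[of n] by simp
      also have "\<dots> = (\<integral>\<omega>. (\<Sum>j\<in>J. t j * S n j \<omega>)\<^sup>2 \<partial>M)"
        by (simp add: W_S[symmetric] power_divide flip: sum_divide_distrib)
      also have "\<dots> \<le> (\<integral>\<omega>. (\<Sum>j\<in>J. (t j)\<^sup>2 * (S n j \<omega>)\<^sup>2) * card J \<partial>M)"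
      proof (rule integral_mono')
        show "integrable M (\<lambda>\<omega>. (\<Sum>j\<in>J. (t j)\<^sup>2 * (S n j \<omega>)\<^sup>2) * card J)" using S_sq by simp
        show "(\<Sum>j\<in>J. t j * S n j \<omega>)\<^sup>2 \<le> (\<Sum>j\<in>J. (t j)\<^sup>2 * (S n j \<omega>)\<^sup>2) * card J" for \<omega>
          using sum_squared_le_sum_of_squares[of "\<lambda>j. t j * S n j \<omega>" J] by (simp add: power_mult_distrib)
      qed (auto intro!: sum_nonneg mult_nonneg_nonneg)
      also have "\<dots> = (\<Sum>j\<in>J. (t j)\<^sup>2 * (\<integral>\<omega>. (S n j \<omega>)\<^sup>2 \<partial>M)) * card J"
        using S_sq by simp
      also have "\<dots> \<le> (\<Sum>j\<in>J. (t j)\<^sup>2 * K j) * card J"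
        using K by (intro mult_right_mono sum_mono mult_left_mono) auto
      finally show ?thesis .
    qed
    have "(\<lambda>n. \<integral>\<omega>. of_real (indicator A \<omega>) * cis (\<Sum>k<n. W k \<omega> / sqrt (real n)) \<partial>M)
        \<longlonglongrightarrow> of_real (\<integral>\<omega>. indicator A \<omega> * exp (- (\<Sum>i\<in>J. \<Sum>j\<in>J. t i * t j * Sig i j \<omega>) / 2) \<partial>M)"
    proof (rule W.stable_martingale_char_limit[OF _ _ bound, of _ _ 1])
      show "AE \<omega> in M. (\<lambda>n. (\<Sum>k<n. (W k \<omega>)\<^sup>2) / real n) \<longlonglongrightarrow> (\<Sum>i\<in>J. \<Sum>j\<in>J. t i * t j * Sig i j \<omega>)"
        using lim
      proof eventually_elim
        case (elim \<omega>)
        then show ?case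
          unfolding W_def by (intro psd_form_limit(1)[of "\<lambda>k i. D k i \<omega>"] J) auto
      qed
    qed (use Sig A in \<open>auto simp: indicator_def\<close>)
    from LIMSEQ_Suc[OF this] show ?thesis by (simp only: W_S)
  qed
  have S_bound': "\<exists>K. \<forall>n. (\<integral>\<omega>. (S (Suc n) i \<omega>)\<^sup>2 \<partial>M) \<le> K" for i
    using S_bound by blast
  have "stable_conv M (\<lambda>n \<omega> i. S n i \<omega>) (\<lambda>\<omega>. gauss_kernel (\<lambda>i j. Sig i j \<omega>))"
  proof (rule stable_conv_gaussian[where Z = "\<lambda>n \<omega> i. S n i \<omega>" and Sig = Sig])
    show "integrable M (\<lambda>\<omega>. (S (Suc n) i \<omega>)\<^sup>2)" for n i by (rule S_sq)
    show "\<exists>K. \<forall>n. (\<integral>\<omega>. (S (Suc n) i \<omega>)\<^sup>2 \<partial>M) \<le> K" for i by (rule S_bound')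
    show "(\<lambda>\<omega>. S (Suc n) i \<omega>) \<in> borel_measurable M" for n i by (rule S_meas)
  qed (fact assms(1) Sig psd char)+
  moreover have "AE \<omega> in M. centered_gaussian (gauss_kernel (\<lambda>i j. Sig i j \<omega>)) (\<lambda>i j. Sig i j \<omega>)"
    using psd unfolding gauss_kernel_def by eventually_elim (rule centered_gaussian_gauss_map)
  ultimately show ?thesis
    by (intro exI[of _ "\<lambda>\<omega>. gauss_kernel (\<lambda>i j. Sig i j \<omega>)"] conjI gauss_kernel_measurable[OF Sig])
qed

end
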